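(* Let $a<b$ be real numbers, $\sigma>0$ and $x_0=\frac{a+b}{2}$. For $\mu\in\mathbb{R}$ let $L^{\sigma,\mu}=\frac{\sigma^2}{2}\frac{d^2}{dx^2}+\mu\frac{d}{dx}$, let $(X_t)_{t\ge0}$ be the $L^{\sigma,\mu}$-diffusion in $(a,b)$ with jump boundary and deterministic jump distribution $\delta_{x_0}$, and let $\gamma_1(L^{\sigma,\mu},\delta_{x_0})$ denote its spectral gap. Then for all sufficiently large $\mu$ one has $$\gamma_1(L^{\sigma,\mu},\delta_{x_0})<\lambda_0,$$ where $\lambda_0=\frac{\sigma^2\pi^2}{2(b-a)^2}+\frac{\mu^2}{2\sigma^2}$ is the lowest eigenvalue of the selfadjoint operator $-L^{\sigma,\mu}$ in $(a,b)$ with Dirichlet boundary conditions.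
   Context: Diffusion with jump boundary: let $\nu$ be a probability measure on $(a,b)$. The $L^{\sigma,\mu}$-diffusion in $(a,b)$ with jump boundary and jump distribution $\nu$, started at $x\in(a,b)$, is the process $(X_t)_{t\ge0}$ which moves as $x+\sigma B_t+\mu t$ ($B$ a standard one-dimensional Brownian motion) until it first hits $\{a,b\}$; at that time it is instantly relocated to a point chosen according to $\nu$ (independently of the past), then again moves as a Brownian motion with diffusion coefficient $\sigma$ and drift $\mu$ until it next hits $\{a,b\}$, is relocated according to $\nu$, and so on forever. For $\nu=\delta_{x_0}$ it is always relocated to $x_0$. $\mathbb{P}_x$ denotes the law of the process started at $x$. The process has a unique invariant probability distribution $\pi$, and its spectral gap is $$\gamma_1(L^{\sigma,\mu},\nu)=-\lim_{t\to\infty}\frac1t\log\sup_{x\in(a,b)}\bigl\|\mathbb{P}_x(X_t\in\cdot)-\pi\bigr\|_{TV}>0,$$ where $\|\cdot\|_{TV}$ is the total variation distance $\|P-Q\|_{TV}=\sup_A|P(A)-Q(A)|$. It is known that $\gamma_1(L^{\sigma,\mu},\nu)=\min\{\Re\tilde\lambda : \tilde\lambda\neq0,\ -\tilde\lambda \text{ is an eigenvalue of }(\mathcal{L},\mathcal{D}(\mathcal{L}))\}$, where $\mathcal{D}(\mathcal{L})=\{f\in C^2([a,b]): f(a)=f(b)=\int_{(a,b)} f\,d\nu\}$ ($f$ complex valued) and $\mathcal{L}f=\frac{\sigma^2}{2}f''+\mu f'$. The operator $-L^{\sigma,\mu}$ with Dirichlet boundary conditions is selfadjoint in the weighted space $L^2((a,b),e^{2\mu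 x/\sigma^2}dx)$. *)

theory Defs
  imports "HOL-Probability.Probability"
begin

definition brownian_motion :: "'w measure \<Rightarrow> (real \<Rightarrow> 'w \<Rightarrow> real) \<Rightarrow> bool" where
  "brownian_motion M W \<longleftrightarrow>
     prob_space M \<and>
     (\<forall>t\<ge>0. W t \<in> borel_measurable M) \<and>
     (\<forall>\<omega>\<in>space M. W 0 \<omega> = 0 \<and> continuous_on {0..} (\<lambda>t. W t \<omega>)) \<and>
     (\<forall>s t. 0 \<le> s \<longrightarrow> s < t \<longrightarrow>
        distributed M lborel (\<lambda>\<omega>. W t \<omega> - W s \<omega>) (normal_density 0 (sqrt (t - s)))) \<and>
     (\<forall>n (u :: nat \<Rightarrow> real). 0 \<le> u 0 \<longrightarrow> mono u \<longrightarrow>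
        prob_space.indep_vars M (\<lambda>_. borel)
          (\<lambda>i \<omega>. W (u (Suc i)) \<omega> - W (u i) \<omega>) {..<n})"

text \<open>
  The randomness driving the process: \<open>W n\<close> is the Brownian motion used between the
  \<open>n\<close>-th and the \<open>(n+1)\<close>-st visit to the boundary, and \<open>\<xi> n\<close> (for \<open>n \<ge> 1\<close>) is the point to
  which the process is relocated at the \<open>n\<close>-th visit. The last two conditions together say that
  all the \<open>W n\<close> and all the \<open>\<xi> n\<close> are mutually independent.
\<close>

definition jump_driver ::
  "real \<Rightarrow> real \<Rightarrow> real measure \<Rightarrow> 'w measure \<Rightarrow> (nat \<Rightarrow> real \<Rightarrow> 'w \<Rightarrow> real) \<Rightarrow>
   (nat \<Rightarrow> 'w \<Rightarrow> real) \<Rightarrow> bool" where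
  "jump_driver a b \<nu> M W \<xi> \<longleftrightarrow>
     prob_space M \<and>
     prob_space \<nu> \<and> sets \<nu> = sets borel \<and> emeasure \<nu> {a<..<b} = 1 \<and>
     (\<forall>n. brownian_motion M (W n)) \<and>
     (\<forall>n. \<xi> n \<in> borel_measurable M \<and> distr M borel (\<xi> n) = \<nu>) \<and>
     (\<forall>n. prob_space.indep_set M
        (sets (vimage_algebra (space M) (\<xi> n) borel))
        (sets (vimage_algebra (space M) (\<lambda>\<omega>. \<lambda>t\<in>{0..}. W n t \<omega>) (\<Pi>\<^sub>M t\<in>{0..}. borel)))) \<and>
     prob_space.indep_vars M (\<lambda>_. borel \<Otimes>\<^sub>M (\<Pi>\<^sub>M t\<in>{0..}. borel))
        (\<lambda>n \<omega>. (\<xi> n \<omega>, \<lambda>t\<in>{0..}. W n t \<omega>)) UNIV"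

context
  fixes a b \<sigma> \<mu> :: real
    and W :: "nat \<Rightarrow> real \<Rightarrow> 'w \<Rightarrow> real" and \<xi> :: "nat \<Rightarrow> 'w \<Rightarrow> real" and x :: real
begin

definition cycle_path :: "nat \<Rightarrow> real \<Rightarrow> 'w \<Rightarrow> real" where
  "cycle_path n s \<omega> = (if n = 0 then x else \<xi> n \<omega>) + \<sigma> * W n s \<omega> + \<mu> * s"

text \<open>The value is \<open>\<infinity>\<close> if the boundary is never reached (a null event).\<close>

definition cycle_length :: "nat \<Rightarrow> 'w \<Rightarrow> ereal" where
  "cycle_length n \<omega> = (INF s\<in>{s. 0 \<le> s \<and> cycle_path n s \<omega> \<in> {a, b}}. ereal s)"

definition jump_time :: "nat \<Rightarrow> 'w \<Rightarrow> ereal" where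
  "jump_time n \<omega> = (\<Sum>i<n. cycle_length i \<omega>)"

text \<open>
  The index of the cycle running at time \<open>t\<close> is the least \<open>n\<close> with \<open>t < jump_time (n + 1)\<close>.
  The default value \<open>x\<close> is used only if the jump times accumulate before \<open>t\<close> (a null event).
\<close>

definition jump_diffusion :: "real \<Rightarrow> 'w \<Rightarrow> real" where
  "jump_diffusion t \<omega> =
     (if \<exists>n. ereal t < jump_time (Suc n) \<omega>
      then let n = (LEAST n. ereal t < jump_time (Suc n) \<omega>)
           in cycle_path n (t - real_of_ereal (jump_time n \<omega>)) \<omega>
      else x)"

end

definition jump_law ::
  "real \<Rightarrow> real \<Rightarrow> real \<Rightarrow> real \<Rightarrow> 'w measure \<Rightarrow> (nat \<Rightarrow> real \<Rightarrow> 'w \<Rightarrow> real) \<Rightarrow>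
   (nat \<Rightarrow> 'w \<Rightarrow> real) \<Rightarrow> real \<Rightarrow> real \<Rightarrow> real measure" where
  "jump_law a b \<sigma> \<mu> M W \<xi> x t = distr M borel (jump_diffusion a b \<sigma> \<mu> W \<xi> x t)"

definition tv_dist :: "real measure \<Rightarrow> real measure \<Rightarrow> real" where
  "tv_dist P Q = (SUP A\<in>sets borel. \<bar>measure P A - measure Q A\<bar>)"

definition invariant_distribution ::
  "real \<Rightarrow> real \<Rightarrow> (real \<Rightarrow> real \<Rightarrow> real measure) \<Rightarrow> real measure \<Rightarrow> bool" where
  "invariant_distribution a b P \<rho> \<longleftrightarrow>
     prob_space \<rho> \<and> sets \<rho> = sets borel \<and> emeasure \<rho> {a<..<b} = 1 \<and>
     (\<forall>t\<ge>0. \<forall>A\<in>sets borel. (\<integral>\<^sup>+x\<in>{a<..<b}. emeasure (P x t) A \<partial>\<rho>) = emeasure \<rho> A)"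

text \<open>
  \<open>P x t\<close> is the law at time \<open>t\<close> of the process started at \<open>x\<close>. The spectral gap is rendered as
  a relation, since it is a limit.
\<close>

definition is_spectral_gap ::
  "real \<Rightarrow> real \<Rightarrow> (real \<Rightarrow> real \<Rightarrow> real measure) \<Rightarrow> real \<Rightarrow> bool" where
  "is_spectral_gap a b P \<gamma> \<longleftrightarrow>
     (\<exists>\<rho>. invariant_distribution a b P \<rho> \<and>
        ((\<lambda>t. - (1 / t * ln (SUP x\<in>{a<..<b}. tv_dist (P x t) \<rho>))) \<longlongrightarrow> \<gamma>) at_top)"

text \<open>
  The domain of the selfadjoint Dirichlet operator in \<open>L\<^sup>2((a,b), e\<^bsup>2\<mu>x/\<sigma>\<^sup>2\<^esup> dx)\<close>: complex functions
  \<open>f\<close> with \<open>f\<close> and \<open>f'\<close> absolutely continuous on \<open>[a,b]\<close>, \<open>f''\<close> in the weighted \<open>L\<^sup>2\<close> space,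
  and \<open>f(a) = f(b) = 0\<close>. The functions \<open>g\<close> and \<open>h\<close> are \<open>f'\<close> and \<open>f''\<close>.
\<close>

definition dirichlet_domain ::
  "real \<Rightarrow> real \<Rightarrow> real \<Rightarrow> real \<Rightarrow> (real \<Rightarrow> complex) \<Rightarrow> (real \<Rightarrow> complex) \<Rightarrow> (real \<Rightarrow> complex) \<Rightarrow> bool"
  where
  "dirichlet_domain a b \<sigma> \<mu> f g h \<longleftrightarrow>
     h \<in> borel_measurable borel \<and>
     set_integrable lborel {a..b} (\<lambda>x. (cmod (h x))\<^sup>2 * exp (2 * \<mu> * x / \<sigma>\<^sup>2)) \<and>
     (\<forall>x\<in>{a..b}. g x = g a + (LBINT y:{a..x}. h y)) \<and>
     (\<forall>x\<in>{a..b}. f x = f a + (LBINT y:{a..x}. g y)) \<and>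
     f a = 0 \<and> f b = 0"

definition dirichlet_eigenvalues :: "real \<Rightarrow> real \<Rightarrow> real \<Rightarrow> real \<Rightarrow> complex set" where
  "dirichlet_eigenvalues a b \<sigma> \<mu> =
     {l. \<exists>f g h. dirichlet_domain a b \<sigma> \<mu> f g h \<and> (\<exists>x\<in>{a..b}. f x \<noteq> 0) \<and>
        (AE x in lborel. x \<in> {a..b} \<longrightarrow>
           - (of_real (\<sigma>\<^sup>2 / 2) * h x + of_real \<mu> * g x) = l * f x)}"

definition is_lowest_eigenvalue :: "real \<Rightarrow> complex set \<Rightarrow> bool" where
  "is_lowest_eigenvalue l E \<longleftrightarrow> of_real l \<in> E \<and> (\<forall>z\<in>E. z \<in> \<real> \<and> l \<le> Re z)"

end

theory Submission
  imports Defs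
begin

text \<open>
  The bound on the spectral gap comes from one function. Put \<open>\<kappa> = 4 * pi / (b - a)\<close>. The points
  \<open>a\<close>, \<open>x0\<close>, \<open>b\<close> are half an interval length apart, so \<open>y \<mapsto> exp (\<i> \<kappa> y)\<close> takes the same value at all
  three and does not notice the relocations to \<open>x0\<close>. Seen through this function the process is
  \<open>x + \<sigma> B\<^sub>t + \<mu> t\<close> with one Brownian motion \<open>B\<close>, glued from the pieces between the jumps. Therefore
  \<open>exp (\<i> \<kappa> X\<^sub>t)\<close> has expectation \<open>exp (\<i> \<kappa> (x + \<mu> t)) * exp (- (\<kappa> \<sigma>)\<^sup>2 t / 2)\<close>
  (lemma \<open>char_jump_law\<close>). If two starting points are in opposite phase, their laws at the times when
  the drift has completed whole periods differ by at least a multiple of \<open>exp (- (\<kappa> \<sigma>)\<^sup>2 t / 2)\<close> in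
  total variation, and both are close to the invariant law at the rate of the gap. Hence
  \<open>\<gamma> \<le> (\<kappa> \<sigma>)\<^sup>2 / 2 = 8 pi\<^sup>2 \<sigma>\<^sup>2 / (b - a)\<^sup>2\<close> for every \<open>\<mu> > 0\<close> (lemma \<open>spectral_gap_le\<close>). The bound is
  independent of \<open>\<mu>\<close>, whereas \<open>\<lambda>\<^sub>0\<close> grows like \<open>\<mu>\<^sup>2\<close>.

  The strong Markov property behind the gluing is used only for the exponential martingale
  \<open>exp (\<i> \<theta> B\<^sub>t + \<theta>\<^sup>2 t / 2)\<close>. For one Brownian motion, its expectation stays \<open>1\<close> when it is stopped at
  the hitting time of a closed set or at a fixed time, whichever comes first
  (\<open>optional_stopping_exp_mart\<close>). Independence of the pieces then propagates this from one cycle to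
  the next (\<open>integral_exp_mart_glued\<close>). To let the number of cycles tend to infinity one needs that
  almost surely the jumps do not accumulate (\<open>AE_exit_times_accumulate\<close>); this follows from the same
  optional stopping identity, which forces the exit time from \<open>(a, b)\<close> to be bounded away from \<open>0\<close>
  with probability at least one half.

  The Dirichlet eigenvalues are found by removing the drift: \<open>u x = exp (\<mu> x / \<sigma>\<^sup>2) * f x\<close> satisfies
  \<open>u'' = - k u\<close>, and the two travelling wave combinations of \<open>u'\<close> and \<open>u\<close> show that
  \<open>k = (n pi / (b - a))\<^sup>2\<close> for a nonzero integer \<open>n\<close> (\<open>dirichlet_oscillator\<close>).
\<close>

section \<open>Dirichlet eigenvalues of the generator\<close>

lemma integral_FTC_complex:
  fixes F :: "real \<Rightarrow> complex"
  assumes "x \<in> {a..b}" "\<And>y. (F has_vector_derivative f y) (at y)" "continuous_on UNIV f"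
  shows "F x = F a + (LBINT y:{a..x}. f y)"
proof -
  have "(LBINT y:{a..x}. f y) = F x - F a"
    unfolding set_lebesgue_integral_def
    using assms by (intro integral_FTC_atLeastAtMost)
      (auto intro: has_vector_derivative_at_within continuous_on_subset)
  then show ?thesis by simp
qed

text \<open>
  The eigenfunction is \<open>exp (- \<mu> x / \<sigma>\<^sup>2) * sin (pi (x - a) / (b - a))\<close>, the lowest Dirichlet sine mode
  with the drift put back in.
\<close>

lemma dirichlet_ground_state:
  assumes ab: "a < b" and \<sigma>: "\<sigma> > 0"
  shows "complex_of_real (\<sigma>\<^sup>2 * pi\<^sup>2 / (2 * (b - a)\<^sup>2) + \<mu>\<^sup>2 / (2 * \<sigma>\<^sup>2)) \<in> dirichlet_eigenvalues a b \<sigma> \<mu>"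
proof -
  define \<alpha> where "\<alpha> = - \<mu> / \<sigma>\<^sup>2"
  define \<beta> where "\<beta> = pi / (b - a)"
  define l where "l = \<sigma>\<^sup>2 * pi\<^sup>2 / (2 * (b - a)\<^sup>2) + \<mu>\<^sup>2 / (2 * \<sigma>\<^sup>2)"
  define fr where "fr x = exp (\<alpha> * x) * sin (\<beta> * (x - a))" for x
  define gr where "gr x = exp (\<alpha> * x) * (\<alpha> * sin (\<beta> * (x - a)) + \<beta> * cos (\<beta> * (x - a)))" for x
  define hr where "hr x = exp (\<alpha> * x) * ((\<alpha>\<^sup>2 - \<beta>\<^sup>2) * sin (\<beta> * (x - a)) + 2 * \<alpha> * \<beta> * cos (\<beta> * (x - a)))" for x
  define f g h where "f x = complex_of_real (fr x)" and "g x = complex_of_real (gr x)" and "h x = complex_of_real (hr x)" for x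
  have df: "(f has_vector_derivative g x) (at x)" for x
  proof -
    have "(fr has_field_derivative gr x) (at x)"
      unfolding fr_def[abs_def] gr_def
      by (auto intro!: derivative_eq_intros simp: algebra_simps)
    then show ?thesis unfolding f_def g_def
      by (intro has_vector_derivative_of_real) (simp add: has_real_derivative_iff_has_vector_derivative)
  qed
  have dg: "(g has_vector_derivative h x) (at x)" for x
  proof -
    have "(gr has_field_derivative hr x) (at x)"
      unfolding gr_def[abs_def] hr_def
      by (auto intro!: derivative_eq_intros simp: algebra_simps power2_eq_square)
    then show ?thesis unfolding g_def h_def
      by (intro has_vector_derivative_of_real) (simp add: has_real_derivative_iff_has_vector_derivative)
  qed
  have cg: "continuous_on UNIV g" and ch: "continuous_on UNIV h"
    unfolding g_def gr_def h_def hr_def by (intro continuous_intros)+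
  have "dirichlet_domain a b \<sigma> \<mu> f g h"
    unfolding dirichlet_domain_def
  proof (intro conjI ballI)
    show "h \<in> borel_measurable borel" by (rule borel_measurable_continuous_onI[OF ch])
    show "set_integrable lborel {a..b} (\<lambda>x. (cmod (h x))\<^sup>2 * exp (2 * \<mu> * x / \<sigma>\<^sup>2))"
      by (intro borel_integrable_atLeastAtMost' continuous_intros continuous_on_subset[OF ch]) (use \<sigma> in auto)
    show "g x = g a + (LBINT y:{a..x}. h y)" if "x \<in> {a..b}" for x
      by (rule integral_FTC_complex[OF that dg ch])
    show "f x = f a + (LBINT y:{a..x}. g y)" if "x \<in> {a..b}" for x
      by (rule integral_FTC_complex[OF that df cg])
    show "f a = 0" by (simp add: f_def fr_def)
    show "f b = 0" using ab by (simp add: f_def fr_def \<beta>_def)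
  qed
  moreover have "\<exists>x\<in>{a..b}. f x \<noteq> 0"
  proof (rule bexI[of _ "(a + b) / 2"])
    have "\<beta> * ((a + b) / 2 - a) = pi / 2" using ab by (simp add: \<beta>_def field_simps)
    then show "f ((a + b) / 2) \<noteq> 0" by (simp add: f_def fr_def)
  qed (use ab in auto)
  moreover have "- (of_real (\<sigma>\<^sup>2 / 2) * h x + of_real \<mu> * g x) = of_real l * f x" for x
  proof -
    have l: "l = \<sigma>\<^sup>2 * \<beta>\<^sup>2 / 2 + \<sigma>\<^sup>2 * \<alpha>\<^sup>2 / 2" and m: "\<mu> = - \<sigma>\<^sup>2 * \<alpha>"
      using \<sigma> by (auto simp: l_def \<beta>_def \<alpha>_def power_divide power2_eq_square mult_ac)
    have "- (\<sigma>\<^sup>2 / 2 * hr x + \<mu> * gr x) = l * fr x"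
      unfolding l m hr_def gr_def fr_def by (simp add: algebra_simps power2_eq_square)
    from arg_cong[OF this, of complex_of_real] show ?thesis
      by (simp only: f_def g_def h_def of_real_mult of_real_add of_real_minus)
  qed
  ultimately show ?thesis
    unfolding dirichlet_eigenvalues_def l_def[symmetric] by blast
qed

text \<open>
  On a bounded interval the exponential weight is bounded below, and \<open>|h| \<le> 1 + |h|\<^sup>2\<close>.
\<close>

lemma set_integrable_of_weighted_square:
  fixes h :: "real \<Rightarrow> complex"
  assumes h[measurable]: "h \<in> borel_measurable borel"
    and sq: "set_integrable lborel {a..b} (\<lambda>x. (cmod (h x))\<^sup>2 * exp (c * x))"
  shows "set_integrable lborel {a..b} h"
proof -
  have eq: "exp (- (c * x)) * ((cmod (h x))\<^sup>2 * exp (c * x)) = (cmod (h x))\<^sup>2" for x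
    by (simp add: mult.commute[of _ "exp (c * x)"] mult.assoc[symmetric] flip: exp_add)
  define K where "K = exp (\<bar>c\<bar> * max \<bar>a\<bar> \<bar>b\<bar>)"
  have K: "exp (- (c * x)) \<le> K" if "x \<in> {a..b}" for x
  proof -
    have "- (c * x) \<le> \<bar>c\<bar> * \<bar>x\<bar>" by (metis abs_ge_minus_self abs_mult)
    also have "\<dots> \<le> \<bar>c\<bar> * max \<bar>a\<bar> \<bar>b\<bar>" using that by (intro mult_left_mono) auto
    finally show ?thesis by (simp add: K_def)
  qed
  have "set_integrable lborel {a..b} (\<lambda>x. 1 + K * ((cmod (h x))\<^sup>2 * exp (c * x)))"
    by (intro set_integral_add set_integrable_mult_right sq borel_integrable_atLeastAtMost') auto
  then show ?thesis
  proof (rule set_integrable_bound)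
    show "set_borel_measurable lborel {a..b} h" unfolding set_borel_measurable_def by measurable
    show "AE x in lborel. x \<in> {a..b} \<longrightarrow> cmod (h x) \<le> norm (1 + K * ((cmod (h x))\<^sup>2 * exp (c * x)))"
    proof (intro AE_I2 impI)
      fix x assume x: "x \<in> {a..b}"
      have "cmod (h x) \<le> 1 + (cmod (h x))\<^sup>2"
      proof -
        have "0 \<le> (cmod (h x) - 1)\<^sup>2" by simp
        then have "2 * cmod (h x) \<le> (cmod (h x))\<^sup>2 + 1" by (simp add: power2_diff)
        then show ?thesis using norm_ge_zero[of "h x"] by linarith
      qed
      also have "(cmod (h x))\<^sup>2 \<le> K * ((cmod (h x))\<^sup>2 * exp (c * x))"
        using mult_right_mono[OF K[OF x], of "(cmod (h x))\<^sup>2 * exp (c * x)"] unfolding eq by simp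
      finally show "cmod (h x) \<le> norm (1 + K * ((cmod (h x))\<^sup>2 * exp (c * x)))" by simp
    qed
  qed
qed

lemma antiderivative_continuous:
  fixes F f :: "real \<Rightarrow> complex"
  assumes f: "continuous_on {a..b} f" and F: "\<And>x. x \<in> {a..b} \<Longrightarrow> F x = F a + (LBINT y:{a..x}. f y)"
    and x: "x \<in> {a..b}"
  shows "(F has_vector_derivative f x) (at x within {a..b})"
proof -
  have "F y = F a + integral {a..y} f" if "y \<in> {a..b}" for y
  proof -
    have "set_integrable lborel {a..y} f"
      using that by (intro borel_integrable_atLeastAtMost' continuous_on_subset[OF f]) auto
    then show ?thesis using F[OF that] by (simp add: set_borel_integral_eq_integral(2))
  qed
  moreover have "((\<lambda>y. F a + integral {a..y} f) has_vector_derivative f x) (at x within {a..b})"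
    using integral_has_vector_derivative[OF f x] by (auto intro!: derivative_eq_intros)
  ultimately show ?thesis
    by (rule has_vector_derivative_transform[OF x])
qed

text \<open>
  The domain describes \<open>f\<close>, \<open>f'\<close>, \<open>f''\<close> through Lebesgue integrals. For an eigenfunction the equation
  identifies \<open>h\<close> almost everywhere with a continuous function of \<open>f\<close> and \<open>g\<close>, so \<open>f\<close> is a classical
  solution of the equation written as a first-order system.
\<close>

lemma dirichlet_domain_derivatives:
  assumes D: "dirichlet_domain a b \<sigma> \<mu> f g h" and ab: "a < b" and \<sigma>: "\<sigma> > 0"
    and ev: "AE x in lborel. x \<in> {a..b} \<longrightarrow> - (of_real (\<sigma>\<^sup>2 / 2) * h x + of_real \<mu> * g x) = l * f x"
    and x: "x \<in> {a..b}"
  shows "(f has_vector_derivative g x) (at x within {a..b})"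
    and "(g has_vector_derivative - (of_real (2 / \<sigma>\<^sup>2) * (of_real \<mu> * g x + l * f x))) (at x within {a..b})"
proof -
  define h' where "h' x = - (of_real (2 / \<sigma>\<^sup>2) * (of_real \<mu> * g x + l * f x))" for x
  have h[measurable]: "h \<in> borel_measurable borel"
    and sq: "set_integrable lborel {a..b} (\<lambda>x. (cmod (h x))\<^sup>2 * exp (2 * \<mu> * x / \<sigma>\<^sup>2))"
    and g: "\<And>x. x \<in> {a..b} \<Longrightarrow> g x = g a + (LBINT y:{a..x}. h y)"
    and f: "\<And>x. x \<in> {a..b} \<Longrightarrow> f x = f a + (LBINT y:{a..x}. g y)"
    using D unfolding dirichlet_domain_def by blast+
  have hi: "set_integrable lborel {a..b} h"
    by (rule set_integrable_of_weighted_square[OF h, of _ _ "2 * \<mu> / \<sigma>\<^sup>2"]) (use sq in simp)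
  have cg: "continuous_on {a..b} g"
  proof -
    have "h integrable_on {a..b}" by (rule set_borel_integral_eq_integral(1)[OF hi])
    then have "continuous_on {a..b} (\<lambda>x. g a + integral {a..x} h)"
      by (intro continuous_intros indefinite_integral_continuous_1)
    moreover have "g a + integral {a..x} h = g x" if "x \<in> {a..b}" for x
    proof -
      have "set_integrable lborel {a..x} h" using that by (intro set_integrable_subset[OF hi]) auto
      then show ?thesis using g[OF that] by (simp add: set_borel_integral_eq_integral(2))
    qed
    ultimately show ?thesis by (rule continuous_on_eq)
  qed
  have df: "(f has_vector_derivative g x) (at x within {a..b})" if "x \<in> {a..b}" for x
    by (rule antiderivative_continuous[OF cg f that])
  then have cf: "continuous_on {a..b} f"
    by (rule continuous_on_vector_derivative)
  have ch': "continuous_on {a..b} h'" unfolding h'_def by (intro continuous_intros cf cg)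
  have hh': "AE x in lborel. x \<in> {a..b} \<longrightarrow> h x = h' x"
    using ev
  proof eventually_elim
    case (elim x)
    show ?case
    proof
      assume "x \<in> {a..b}"
      with elim have e: "l * f x = - (of_real (\<sigma>\<^sup>2 / 2) * h x + of_real \<mu> * g x)" by simp
      show "h x = h' x" unfolding h'_def e using \<sigma> by (simp add: field_simps)
    qed
  qed
  have g': "g x = g a + (LBINT y:{a..x}. h' y)" if "x \<in> {a..b}" for x
  proof -
    have "(LBINT y:{a..x}. h y) = (LBINT y:{a..x}. h' y)"
      unfolding set_lebesgue_integral_def
    proof (rule integral_cong_AE)
      show "(\<lambda>y. indicator {a..x} y *\<^sub>R h y) \<in> borel_measurable lborel" by measurable
      have "integrable lborel (\<lambda>y. indicator {a..x} y *\<^sub>R h' y)"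
        using that by (intro borel_integrable_compact continuous_on_subset[OF ch']) auto
      then show "(\<lambda>y. indicator {a..x} y *\<^sub>R h' y) \<in> borel_measurable lborel" by simp
      show "AE y in lborel. indicator {a..x} y *\<^sub>R h y = indicator {a..x} y *\<^sub>R h' y"
        using hh' by eventually_elim (use that in \<open>auto simp: indicator_def\<close>)
    qed
    then show ?thesis using g[OF that] by simp
  qed
  show "(f has_vector_derivative g x) (at x within {a..b})" by (rule df[OF x])
  show "(g has_vector_derivative - (of_real (2 / \<sigma>\<^sup>2) * (of_real \<mu> * g x + l * f x))) (at x within {a..b})"
    using antiderivative_continuous[OF ch' g' x] by (simp add: h'_def)
qed

lemma exp_linear_has_vector_derivative:
  "((\<lambda>x. exp (c * of_real x)) has_vector_derivative c * exp (c * of_real x)) (at x within S)" for c :: complex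
proof -
  have "((\<lambda>z. exp (c * z)) has_field_derivative c * exp (c * of_real x)) (at (of_real x))"
    by (auto intro!: derivative_eq_intros)
  from has_vector_derivative_real_field[OF this] show ?thesis .
qed

lemma zero_vector_derivative_eq:
  fixes F :: "real \<Rightarrow> complex"
  assumes "\<And>x. x \<in> {a..b} \<Longrightarrow> (F has_vector_derivative 0) (at x within {a..b})" "x \<in> {a..b}"
  shows "F x = F a"
proof -
  obtain c where "\<And>x. x \<in> {a..b} \<Longrightarrow> F x = c"
    using has_vector_derivative_zero_constant[of "{a..b}" F] assms(1) by auto
  then show ?thesis using assms(2) by auto
qed

text \<open>
  With \<open>w\<^sup>2 = k\<close>, each of \<open>u' + c u\<close>, \<open>c = \<plusminus> \<i> w\<close>, satisfies a first-order equation and is an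
  exponential. Both boundary conditions together give \<open>exp (2 \<i> w (b - a)) = 1\<close> unless \<open>u\<close> vanishes
  identically, so \<open>w\<close> is a real multiple of \<open>pi / (b - a)\<close>; this also gives that \<open>k\<close> is real.
\<close>

lemma dirichlet_oscillator:
  fixes u v :: "real \<Rightarrow> complex"
  assumes ab: "a < b"
    and u: "\<And>x. x \<in> {a..b} \<Longrightarrow> (u has_vector_derivative v x) (at x within {a..b})"
    and v: "\<And>x. x \<in> {a..b} \<Longrightarrow> (v has_vector_derivative - (k * u x)) (at x within {a..b})"
    and bc: "u a = 0" "u b = 0" and nz: "x0 \<in> {a..b}" "u x0 \<noteq> 0"
  shows "k \<in> \<real> \<and> (pi / (b - a))\<^sup>2 \<le> Re k"
proof -
  define w where "w = csqrt k"
  have w: "k = w * w" using power2_csqrt[of k] by (simp add: w_def power2_eq_square)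
  have wave: "v x + c * u x = exp (c * of_real (x - a)) * v a"
    if c: "c * c = - k" and x: "x \<in> {a..b}" for c x
  proof -
    let ?F = "\<lambda>x. exp (- c * of_real x) * (v x + c * u x)"
    have "(?F has_vector_derivative 0) (at x within {a..b})" if "x \<in> {a..b}" for x
    proof -
      have "((\<lambda>x. v x + c * u x) has_vector_derivative - (k * u x) + c * v x) (at x within {a..b})"
        by (intro has_vector_derivative_add v u that has_vector_derivative_mult_right)
      from has_vector_derivative_mult[OF exp_linear_has_vector_derivative[of "- c"] this]
      have "(?F has_vector_derivative exp (- c * of_real x) * (- (k * u x) + c * v x)
          + (- c * exp (- c * of_real x)) * (v x + c * u x)) (at x within {a..b})" .
      also have "exp (- c * of_real x) * (- (k * u x) + c * v x)
          + (- c * exp (- c * of_real x)) * (v x + c * u x) = exp (- c * of_real x) * (- k - c * c) * u x"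
        by (simp add: algebra_simps)
      finally show ?thesis using c by simp
    qed
    from zero_vector_derivative_eq[OF this x]
    have "exp (- c * of_real x) * (v x + c * u x) = exp (- c * of_real a) * v a"
      by (simp add: bc)
    then have "exp (c * of_real x) * (exp (- c * of_real x) * (v x + c * u x))
        = exp (c * of_real x) * (exp (- c * of_real a) * v a)" by simp
    then show ?thesis
      unfolding mult.assoc[symmetric] exp_add[symmetric] by (simp add: right_diff_distrib)
  qed
  have c1: "\<i> * w * (\<i> * w) = - k" and c2: "- (\<i> * w) * - (\<i> * w) = - k" by (simp_all add: w algebra_simps)
  have u_const: "u x = u a" if "\<And>x. x \<in> {a..b} \<Longrightarrow> v x = 0" "x \<in> {a..b}" for x
    by (rule zero_vector_derivative_eq[OF _ that(2)]) (use u that(1) in force)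
  have va: "v a \<noteq> 0"
  proof
    assume 0: "v a = 0"
    have "v x = 0" if "x \<in> {a..b}" for x
      using wave[OF c1 that] wave[OF c2 that] by (simp add: 0)
    from u_const[OF this nz(1)] nz(2) bc show False by simp
  qed
  have b: "b \<in> {a..b}" using ab by simp
  have "exp (\<i> * w * of_real (b - a)) * v a = exp (- (\<i> * w) * of_real (b - a)) * v a"
    using wave[OF c1 b] wave[OF c2 b] by (simp add: bc)
  then have "exp (\<i> * w * of_real (b - a)) = exp (- (\<i> * w) * of_real (b - a))" using va by simp
  then have "exp (\<i> * w * of_real (b - a)) * exp (\<i> * w * of_real (b - a)) = 1"
    by (metis exp_minus_inverse minus_mult_left)
  then have "exp (2 * (\<i> * w * of_real (b - a))) = 1" by (simp add: exp_double power2_eq_square)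
  then obtain n :: int where n: "Re (2 * (\<i> * w * of_real (b - a))) = 0"
      "Im (2 * (\<i> * w * of_real (b - a))) = of_int (2 * n) * pi"
    unfolding exp_eq_1 by blast
  have Im: "Im w = 0" using n(1) ab by simp
  have Re: "Re w = of_int n * (pi / (b - a))" using n(2) ab by (simp add: field_simps)
  have w': "w = of_real (of_int n * (pi / (b - a)))" using Im Re by (simp add: complex_eq_iff)
  \<comment> \<open>For \<open>w = 0\<close> the function \<open>u\<close> is linear and cannot vanish at both ends.\<close>
  have "n \<noteq> 0"
  proof
    assume "n = 0"
    then have w0: "w = 0" by (simp add: w')
    have vc: "v x = v a" if "x \<in> {a..b}" for x using wave[OF c1 that] by (simp add: w0)
    have "((\<lambda>x. u x - of_real x * v a) has_vector_derivative 0) (at x within {a..b})" if "x \<in> {a..b}" for x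
      using u[OF that] vc[OF that] by (auto intro!: derivative_eq_intros)
    from zero_vector_derivative_eq[of a b "\<lambda>x. u x - of_real x * v a", OF this b]
    have "of_real (b - a) * v a = 0" by (simp add: bc algebra_simps)
    then show False using va ab by simp
  qed
  then have "1 \<le> n\<^sup>2" by (simp add: int_one_le_iff_zero_less)
  then have n1: "(1::real) \<le> (of_int n)\<^sup>2" by (metis of_int_1_le_iff of_int_power)
  have k: "k = of_real ((of_int n)\<^sup>2 * (pi / (b - a))\<^sup>2)"
    unfolding w w' of_real_mult[symmetric] by (rule arg_cong[of _ _ of_real]) (simp add: power2_eq_square)
  from n1 have "1 * (pi / (b - a))\<^sup>2 \<le> (of_int n)\<^sup>2 * (pi / (b - a))\<^sup>2" by (intro mult_right_mono) auto
  then show ?thesis unfolding k by simp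
qed

text \<open>
  Multiplication by \<open>exp (\<mu> x / \<sigma>\<^sup>2)\<close> removes the first-order term and shifts the eigenvalue by
  \<open>\<mu>\<^sup>2 / (2 \<sigma>\<^sup>2)\<close>.
\<close>

lemma dirichlet_eigenvalue_ge:
  assumes ab: "a < b" and \<sigma>: "\<sigma> > 0" and l: "l \<in> dirichlet_eigenvalues a b \<sigma> \<mu>"
  shows "l \<in> \<real> \<and> \<sigma>\<^sup>2 * pi\<^sup>2 / (2 * (b - a)\<^sup>2) + \<mu>\<^sup>2 / (2 * \<sigma>\<^sup>2) \<le> Re l"
proof -
  obtain f g h x0 where D: "dirichlet_domain a b \<sigma> \<mu> f g h"
    and ev: "AE x in lborel. x \<in> {a..b} \<longrightarrow> - (of_real (\<sigma>\<^sup>2 / 2) * h x + of_real \<mu> * g x) = l * f x"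
    and x0: "x0 \<in> {a..b}" "f x0 \<noteq> 0"
    using l unfolding dirichlet_eigenvalues_def by blast
  note df = dirichlet_domain_derivatives(1)[OF D ab \<sigma> ev] and dg = dirichlet_domain_derivatives(2)[OF D ab \<sigma> ev]
  define c where "c = complex_of_real (\<mu> / \<sigma>\<^sup>2)"
  define k where "k = of_real (2 / \<sigma>\<^sup>2) * l - c * c"
  define u where "u x = exp (c * of_real x) * f x" for x
  define v where "v x = exp (c * of_real x) * (g x + c * f x)" for x
  have du: "(u has_vector_derivative v x) (at x within {a..b})" if "x \<in> {a..b}" for x
    using has_vector_derivative_mult[OF exp_linear_has_vector_derivative[of c] df[OF that]]
    unfolding u_def v_def by (simp add: algebra_simps)
  have dv: "(v has_vector_derivative - (k * u x)) (at x within {a..b})" if "x \<in> {a..b}" for x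
  proof -
    have "((\<lambda>x. g x + c * f x) has_vector_derivative
        - (of_real (2 / \<sigma>\<^sup>2) * (of_real \<mu> * g x + l * f x)) + c * g x) (at x within {a..b})"
      by (intro has_vector_derivative_add dg df that has_vector_derivative_mult_right)
    from has_vector_derivative_mult[OF exp_linear_has_vector_derivative[of c] this]
    have "(v has_vector_derivative exp (c * of_real x) *
        (- (of_real (2 / \<sigma>\<^sup>2) * (of_real \<mu> * g x + l * f x)) + c * g x) +
        c * exp (c * of_real x) * (g x + c * f x)) (at x within {a..b})"
      unfolding v_def .
    also have "of_real (2 / \<sigma>\<^sup>2) * (of_real \<mu> * g x + l * f x) = 2 * c * g x + of_real (2 / \<sigma>\<^sup>2) * l * f x"
      by (simp add: c_def distrib_left mult.assoc)
    also have "exp (c * of_real x) * (- (2 * c * g x + of_real (2 / \<sigma>\<^sup>2) * l * f x) + c * g x)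
        + c * exp (c * of_real x) * (g x + c * f x) = - (k * u x)"
      unfolding k_def u_def by (simp add: algebra_simps del: of_real_divide)
    finally show ?thesis .
  qed
  have "f a = 0" "f b = 0" using D unfolding dirichlet_domain_def by blast+
  then have "u a = 0" "u b = 0" "u x0 \<noteq> 0" using x0 by (auto simp: u_def)
  with dirichlet_oscillator[OF ab du dv _ _ x0(1)]
  have k: "k \<in> \<real>" "(pi / (b - a))\<^sup>2 \<le> Re k" by auto
  obtain q where q: "k = of_real q" using k(1) by (rule Reals_cases)
  have "l = of_real (\<sigma>\<^sup>2 / 2) * (k + c * c)"
    using \<sigma> by (simp add: k_def)
  then have lq: "l = of_real (\<sigma>\<^sup>2 / 2 * (q + (\<mu> / \<sigma>\<^sup>2)\<^sup>2))"
    by (simp only: q c_def power2_eq_square of_real_mult of_real_add)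
  have "\<sigma>\<^sup>2 * pi\<^sup>2 / (2 * (b - a)\<^sup>2) + \<mu>\<^sup>2 / (2 * \<sigma>\<^sup>2) = \<sigma>\<^sup>2 / 2 * ((pi / (b - a))\<^sup>2 + (\<mu> / \<sigma>\<^sup>2)\<^sup>2)"
    using \<sigma> by (simp add: power_divide distrib_left power2_eq_square)
  also have "\<dots> \<le> \<sigma>\<^sup>2 / 2 * (q + (\<mu> / \<sigma>\<^sup>2)\<^sup>2)"
    using k(2) by (intro mult_left_mono add_right_mono) (simp_all add: q)
  finally show ?thesis by (simp only: lq Reals_of_real Re_complex_of_real simp_thms)
qed

lemma lowest_dirichlet_eigenvalue:
  assumes "a < b" "\<sigma> > 0"
  shows "is_lowest_eigenvalue (\<sigma>\<^sup>2 * pi\<^sup>2 / (2 * (b - a)\<^sup>2) + \<mu>\<^sup>2 / (2 * \<sigma>\<^sup>2)) (dirichlet_eigenvalues a b \<sigma> \<mu>)"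
  unfolding is_lowest_eigenvalue_def
  using dirichlet_ground_state[OF assms] dirichlet_eigenvalue_ge[OF assms] by blast

section \<open>Hitting times of continuous paths\<close>

definition hit_time :: "real set \<Rightarrow> (real \<Rightarrow> real) \<Rightarrow> ereal" where
  "hit_time C p = (INF s\<in>{s. 0 \<le> s \<and> p s \<in> C}. ereal s)"

text \<open>
  A condition on finitely many values of the path. The threshold \<open>1 / (m + 1)\<close> is needed because a path
  that stays away from the set at all dyadic times can still hit it at another time.
\<close>

definition dyadic_far :: "real set \<Rightarrow> (real \<Rightarrow> real) \<Rightarrow> real \<Rightarrow> nat \<Rightarrow> nat \<Rightarrow> bool" where
  "dyadic_far C p r m N \<longleftrightarrow>
     (\<forall>j\<le>2 ^ N. inverse (real (Suc m)) \<le> infdist (p (r * real j / 2 ^ N)) C)"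

lemma hit_time_nonneg: "0 \<le> hit_time C p"
  by (auto simp: hit_time_def intro!: INF_greatest)

lemma hit_time_le: "0 \<le> s \<Longrightarrow> p s \<in> C \<Longrightarrow> hit_time C p \<le> ereal s"
  unfolding hit_time_def by (rule INF_lower) auto

text \<open>
  A continuous path meets a closed set in a closed set of times, which contains its infimum.
\<close>

lemma hit_time_attained:
  assumes C: "closed C" and p: "continuous_on {0..} p" and fin: "hit_time C p < \<infinity>"
  obtains s where "0 \<le> s" "hit_time C p = ereal s" "p s \<in> C"
proof -
  let ?S = "{0..} \<inter> p -` C"
  have ne: "?S \<noteq> {}"
    using fin unfolding hit_time_def by (auto simp: top_ereal_def[symmetric] INF_less_iff)
  have cl: "closed ?S"
    using continuous_closed_preimage[OF p _ C] by auto
  have bdd: "bdd_below ?S" by (auto intro: bdd_belowI[of _ 0])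
  have Inf: "Inf ?S \<in> ?S" using closed_contains_Inf[OF ne bdd cl] .
  have "hit_time C p = ereal (Inf ?S)"
    unfolding hit_time_def
    by (rule antisym) (use Inf in \<open>auto intro!: INF_lower INF_greatest cInf_lower bdd\<close>)
  then show ?thesis using that Inf by auto
qed

lemma less_hit_time_iff:
  assumes C: "closed C" and p: "continuous_on {0..} p" and r: "0 \<le> r"
  shows "ereal r < hit_time C p \<longleftrightarrow> (\<forall>s\<in>{0..r}. p s \<notin> C)"
proof
  assume "ereal r < hit_time C p"
  then have "ereal r < ereal s" if "0 \<le> s" "p s \<in> C" for s
    using hit_time_le[of s p C] that by (rule_tac order.strict_trans2)
  then show "\<forall>s\<in>{0..r}. p s \<notin> C" by force
next
  assume *: "\<forall>s\<in>{0..r}. p s \<notin> C"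
  show "ereal r < hit_time C p"
  proof (rule ccontr)
    assume "\<not> ?thesis"
    then have le: "hit_time C p \<le> ereal r" by simp
    then have "hit_time C p < \<infinity>" by (auto simp: order.strict_trans1)
    then obtain s where "0 \<le> s" "hit_time C p = ereal s" "p s \<in> C"
      using hit_time_attained[OF C p] by blast
    with le * show False by auto
  qed
qed

lemma dyadic_far_antimono:
  assumes "dyadic_far C p r m N'" "N \<le> N'"
  shows "dyadic_far C p r m N"
  unfolding dyadic_far_def
proof (intro allI impI)
  fix j :: nat assume j: "j \<le> 2 ^ N"
  have e: "(2::nat) ^ N' = 2 ^ N * 2 ^ (N' - N)" "(2::real) ^ N' = 2 ^ N * 2 ^ (N' - N)"
    using assms(2) by (simp_all flip: power_add)
  have "j * 2 ^ (N' - N) \<le> 2 ^ N'" using j by (simp add: e)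
  then have "inverse (real (Suc m)) \<le> infdist (p (r * real (j * 2 ^ (N' - N)) / 2 ^ N')) C"
    using assms(1) unfolding dyadic_far_def by blast
  also have "r * real (j * 2 ^ (N' - N)) / 2 ^ N' = r * real j / 2 ^ N"
    by (simp add: e)
  finally show "inverse (real (Suc m)) \<le> infdist (p (r * real j / 2 ^ N)) C" .
qed

lemma dyadic_far_mono:
  assumes "dyadic_far C p r m N" "m \<le> m'"
  shows "dyadic_far C p r m' N"
proof -
  have "inverse (real (Suc m')) \<le> inverse (real (Suc m))" using assms(2) by (simp add: field_simps)
  then show ?thesis using assms(1) unfolding dyadic_far_def by (meson order_trans)
qed

lemma dyadic_floor_tendsto:
  fixes x :: real
  assumes "0 \<le> x"
  shows "(\<lambda>N. real (nat \<lfloor>x * 2 ^ N\<rfloor>) / 2 ^ N) \<longlonglongrightarrow> x"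
proof -
  have bnd: "norm (real (nat \<lfloor>x * 2 ^ N\<rfloor>) / 2 ^ N - x) \<le> (1 / 2) ^ N" for N :: nat
  proof -
    have "0 \<le> x * 2 ^ N" using assms by simp
    then have *: "\<bar>real (nat \<lfloor>x * 2 ^ N\<rfloor>) - x * 2 ^ N\<bar> \<le> 1" by linarith
    have "real (nat \<lfloor>x * 2 ^ N\<rfloor>) / 2 ^ N - x = (real (nat \<lfloor>x * 2 ^ N\<rfloor>) - x * 2 ^ N) / 2 ^ N"
      by (simp add: field_simps)
    also have "norm \<dots> \<le> 1 / 2 ^ N" using divide_right_mono[OF *, of "2 ^ N"] by simp
    finally show ?thesis by (simp add: power_one_over)
  qed
  have "(\<lambda>N. (1 / 2 :: real) ^ N) \<longlonglongrightarrow> 0" by (rule LIMSEQ_power_zero) simp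
  from Lim_null_comparison[OF always_eventually[OF allI[OF bnd]] this]
  show ?thesis by (simp add: LIM_zero_iff)
qed

text \<open>
  On the compact interval \<open>[0, r]\<close> a continuous path that avoids a closed set keeps a positive
  distance from it, and by density of the dyadic points this distance is seen on the grids. This is
  what reduces events about hitting times to countably many times.
\<close>

lemma avoid_iff_dyadic_far:
  assumes C: "closed C" "C \<noteq> {}" and p: "continuous_on {0..} p" and r: "0 \<le> r"
  shows "(\<forall>s\<in>{0..r}. p s \<notin> C) \<longleftrightarrow> (\<exists>m. \<forall>N. dyadic_far C p r m N)"
proof
  have pr: "continuous_on {0..r} (\<lambda>s. infdist (p s) C)"
    by (intro continuous_on_infdist continuous_on_subset[OF p]) auto
  {
    assume *: "\<forall>s\<in>{0..r}. p s \<notin> C"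
    obtain s0 where s0: "s0 \<in> {0..r}" "\<And>s. s \<in> {0..r} \<Longrightarrow> infdist (p s0) C \<le> infdist (p s) C"
      using continuous_attains_inf[OF _ _ pr] r by auto
    have "0 < infdist (p s0) C"
      using s0(1) * C by (metis in_closed_iff_infdist_zero infdist_nonneg order_le_less)
    then obtain m where m: "inverse (real (Suc m)) < infdist (p s0) C"
      using reals_Archimedean by blast
    have "dyadic_far C p r m N" for N
      unfolding dyadic_far_def
    proof (intro allI impI)
      fix j :: nat assume "j \<le> 2 ^ N"
      then have "real j \<le> 2 ^ N" by (metis of_nat_le_iff of_nat_numeral of_nat_power)
      then have "r * real j / 2 ^ N \<in> {0..r}"
        using r by (auto simp: field_simps intro: mult_left_mono)
      with s0(2) m show "inverse (real (Suc m)) \<le> infdist (p (r * real j / 2 ^ N)) C"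
        by (meson less_imp_le order_trans)
    qed
    then show "\<exists>m. \<forall>N. dyadic_far C p r m N" by blast
  next
    assume "\<exists>m. \<forall>N. dyadic_far C p r m N"
    then obtain m where m: "\<And>N. dyadic_far C p r m N" by blast
    show "\<forall>s\<in>{0..r}. p s \<notin> C"
    proof
      fix s assume s: "s \<in> {0..r}"
      define q where "q N = r * real (nat \<lfloor>s / r * 2 ^ N\<rfloor>) / 2 ^ N" for N :: nat
      have sr: "0 \<le> s / r" "s / r \<le> 1" using s by (auto simp: divide_le_eq_1)
      have j: "nat \<lfloor>s / r * 2 ^ N\<rfloor> \<le> 2 ^ N" for N :: nat
      proof -
        have "s / r * 2 ^ N \<le> 2 ^ N" using sr mult_right_mono[of "s / r" 1 "2 ^ N"] by simp
        then have "\<lfloor>s / r * 2 ^ N\<rfloor> \<le> 2 ^ N"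
          by (metis floor_mono floor_numeral_power)
        then show ?thesis by (simp add: nat_le_iff)
      qed
      have qin: "q N \<in> {0..r}" for N
      proof -
        have "real (nat \<lfloor>s / r * 2 ^ N\<rfloor>) \<le> 2 ^ N" using j[of N]
          by (metis of_nat_le_iff of_nat_numeral of_nat_power)
        then show ?thesis
          unfolding q_def using r by (auto simp: field_simps intro: mult_left_mono)
      qed
      have qlim: "q \<longlonglongrightarrow> s"
      proof (cases "r = 0")
        case True
        then show ?thesis using s by (auto simp: q_def[abs_def])
      next
        case False
        have "(\<lambda>N. r * (real (nat \<lfloor>s / r * 2 ^ N\<rfloor>) / 2 ^ N)) \<longlonglongrightarrow> r * (s / r)"
          by (intro tendsto_mult_left dyadic_floor_tendsto sr)
        then show ?thesis using False by (simp add: q_def[abs_def])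
      qed
      have "(\<lambda>N. infdist (p (q N)) C) \<longlonglongrightarrow> infdist (p s) C"
        by (rule continuous_on_tendsto_compose[OF pr qlim s]) (use qin in auto)
      moreover have "inverse (real (Suc m)) \<le> infdist (p (q N)) C" for N
        using m[of N] j[of N] unfolding dyadic_far_def q_def by blast
      ultimately have "inverse (real (Suc m)) \<le> infdist (p s) C"
        by (meson LIMSEQ_le_const)
      then have "0 < infdist (p s) C" by (smt (verit) inverse_positive_iff_positive of_nat_0_less_iff zero_less_Suc)
      then show "p s \<notin> C" using infdist_zero by fastforce
    qed
  }
qed

lemma less_hit_time_iff_dyadic_far:
  assumes "closed C" "C \<noteq> {}" "continuous_on {0..} p" "0 \<le> r"
  shows "ereal r < hit_time C p \<longleftrightarrow> (\<exists>m. \<forall>N. dyadic_far C p r m N)"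
  using less_hit_time_iff[of C p r] avoid_iff_dyadic_far[of C p r] assms by simp

text \<open>
  Only the coordinates at fixed times are assumed measurable, so the statement applies to the
  \<open>\<sigma>\<close>-algebra generated by a single Brownian motion; this is what makes exit times of different
  cycles independent.
\<close>

lemma measurable_hit_time:
  assumes C: "closed C" "C \<noteq> {}"
    and p: "\<And>s. 0 \<le> s \<Longrightarrow> p s \<in> borel_measurable N"
    and cont: "\<And>\<omega>. \<omega> \<in> space N \<Longrightarrow> continuous_on {0..} (\<lambda>s. p s \<omega>)"
  shows "(\<lambda>\<omega>. hit_time C (\<lambda>s. p s \<omega>)) \<in> borel_measurable N"
proof (rule borel_measurableI_greater)
  have [measurable]: "(\<lambda>x. infdist x C) \<in> borel_measurable borel"
    by (intro borel_measurable_continuous_onI continuous_intros)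
  fix y :: ereal
  consider (inf) "y = \<infinity>" | (neg) "y < 0" | (real) r where "y = ereal r" "0 \<le> r"
    by (cases y) (force simp: not_less)+
  then show "{\<omega> \<in> space N. y < hit_time C (\<lambda>s. p s \<omega>)} \<in> sets N"
  proof cases
    case neg
    then have "y < hit_time C q" for q using hit_time_nonneg[of C q] by (rule order.strict_trans2)
    then show ?thesis by simp
  next
    case real
    have [measurable]: "p (r * real j / 2 ^ K) \<in> borel_measurable N" for j K :: nat
      using p real by simp
    have "{\<omega> \<in> space N. y < hit_time C (\<lambda>s. p s \<omega>)}
        = {\<omega> \<in> space N. \<exists>m. \<forall>K. dyadic_far C (\<lambda>s. p s \<omega>) r m K}"
      using less_hit_time_iff_dyadic_far[OF C cont] real by auto
    also have "\<dots> \<in> sets N"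
      unfolding dyadic_far_def by measurable
    finally show ?thesis .
  qed simp
qed

text \<open>
  Joint measurability allows the process to be evaluated at random times. The path is frozen at its
  initial value for negative times, so that all real times are admitted.
\<close>

lemma measurable_continuous_process:
  fixes g :: "real \<Rightarrow> 'w \<Rightarrow> real"
  assumes g: "\<And>s. 0 \<le> s \<Longrightarrow> g s \<in> borel_measurable N"
    and cont: "\<And>\<omega>. \<omega> \<in> space N \<Longrightarrow> continuous_on {0..} (\<lambda>s. g s \<omega>)"
  shows "(\<lambda>(s, \<omega>). g (max 0 s) \<omega>) \<in> borel_measurable (borel \<Otimes>\<^sub>M N)"
proof (rule borel_measurable_LIMSEQ_real)
  define h where "h k z = g (real (nat \<lfloor>max 0 (fst z) * 2 ^ k\<rfloor>) / 2 ^ k) (snd z)"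
    for k :: nat and z :: "real \<times> 'w"
  show "h k \<in> borel_measurable (borel \<Otimes>\<^sub>M N)" for k
  proof -
    have [measurable]: "(\<lambda>z. nat \<lfloor>max 0 (fst z) * 2 ^ k :: real\<rfloor>) \<in> borel \<Otimes>\<^sub>M N \<rightarrow>\<^sub>M count_space UNIV"
      by measurable
    have [measurable]: "g (real j / 2 ^ k) \<in> borel_measurable N" for j :: nat
      by (rule g) simp
    show ?thesis
      unfolding h_def[abs_def]
      by (rule measurable_compose_countable[where f="\<lambda>j z. g (real j / 2 ^ k) (snd z)"]) measurable
  qed
  fix z assume z: "z \<in> space ((borel :: real measure) \<Otimes>\<^sub>M N)"
  obtain s \<omega> where z': "z = (s, \<omega>)" "\<omega> \<in> space N"
    using z by (auto simp: space_pair_measure)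
  define q where "q k = real (nat \<lfloor>max 0 s * 2 ^ k\<rfloor>) / 2 ^ k" for k :: nat
  have "q \<longlonglongrightarrow> max 0 s"
    unfolding q_def[abs_def] by (rule dyadic_floor_tendsto) simp
  then have "(\<lambda>k. g (q k) \<omega>) \<longlonglongrightarrow> g (max 0 s) \<omega>"
    by (rule continuous_on_tendsto_compose[OF cont[OF z'(2)]]) (auto simp: q_def)
  then show "(\<lambda>k. h k z) \<longlonglongrightarrow> (case z of (s, \<omega>) \<Rightarrow> g (max 0 s) \<omega>)"
    by (simp add: h_def z' q_def)
qed

section \<open>The stopped exponential martingale of Brownian motion\<close>

text \<open>
  The value at time \<open>s\<close> of the complex exponential martingale of a Brownian motion that is then at \<open>w\<close>.
\<close>

definition exp_mart :: "real \<Rightarrow> real \<Rightarrow> real \<Rightarrow> complex" where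
  "exp_mart \<theta> w s = iexp (\<theta> * w) * of_real (exp (\<theta>\<^sup>2 / 2 * s))"

lemma exp_mart_0 [simp]: "exp_mart \<theta> 0 0 = 1" by (simp add: exp_mart_def)

lemma exp_mart_add: "exp_mart \<theta> (w + w') (s + s') = exp_mart \<theta> w s * exp_mart \<theta> w' s'"
  by (simp add: exp_mart_def distrib_left exp_add)

lemma norm_exp_mart: "norm (exp_mart \<theta> w s) = exp (\<theta>\<^sup>2 / 2 * s)"
  by (simp add: exp_mart_def norm_mult)

lemma measurable_exp_mart [measurable (raw)]:
  assumes [measurable]: "f \<in> borel_measurable M" "g \<in> borel_measurable M"
  shows "(\<lambda>x. exp_mart \<theta> (f x) (g x)) \<in> borel_measurable M"
  unfolding exp_mart_def by measurable

lemma continuous_on_exp_mart [continuous_intros]: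
  assumes "continuous_on S f" "continuous_on S g"
  shows "continuous_on S (\<lambda>x. exp_mart \<theta> (f x) (g x))"
  unfolding exp_mart_def by (intro continuous_intros assms)

lemma (in prob_space) integral_iexp_normal:
  assumes s: "0 < s" and X: "distributed M lborel X (normal_density 0 s)"
  shows "(\<integral>\<omega>. iexp (\<theta> * X \<omega>) \<partial>M) = of_real (exp (- (\<theta>\<^sup>2 * s\<^sup>2 / 2)))"
proof -
  have D: "distributed M lborel (\<lambda>\<omega>. (X \<omega> - 0) / s) std_normal_density"
    using X normal_standard_normal_convert[OF s] by blast
  then have [measurable]: "(\<lambda>\<omega>. X \<omega> / s) \<in> borel_measurable M"
    using distributed_measurable[OF D] by simp
  have "(\<integral>\<omega>. iexp (\<theta> * X \<omega>) \<partial>M) = (\<integral>\<omega>. iexp (\<theta> * s * (X \<omega> / s)) \<partial>M)"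
    using s by simp
  also have "\<dots> = (\<integral>y. iexp (\<theta> * s * y) \<partial>distr M lborel (\<lambda>\<omega>. X \<omega> / s))"
    by (subst integral_distr) auto
  also have "distr M lborel (\<lambda>\<omega>. X \<omega> / s) = std_normal_distribution"
    using distributed_distr_eq_density[OF D] by simp
  also have "(\<integral>y. iexp (\<theta> * s * y) \<partial>std_normal_distribution) = char std_normal_distribution (\<theta> * s)"
    by (simp add: char_def)
  finally show ?thesis
    by (simp add: char_std_normal_distribution power_mult_distrib)
qed

lemma brownian_motionD:
  assumes "brownian_motion M W"
  shows "prob_space M" "0 \<le> t \<Longrightarrow> W t \<in> borel_measurable M"
    "\<omega> \<in> space M \<Longrightarrow> W 0 \<omega> = 0" "\<omega> \<in> space M \<Longrightarrow> continuous_on {0..} (\<lambda>t. W t \<omega>)"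
    "0 \<le> s \<Longrightarrow> s < t \<Longrightarrow>
        distributed M lborel (\<lambda>\<omega>. W t \<omega> - W s \<omega>) (normal_density 0 (sqrt (t - s)))"
    "0 \<le> u 0 \<Longrightarrow> mono u \<Longrightarrow>
        prob_space.indep_vars M (\<lambda>_. borel) (\<lambda>i \<omega>. W (u (Suc i)) \<omega> - W (u i) \<omega>) {..<n::nat}"
  using assms unfolding brownian_motion_def by blast+

lemma brownian_exp_mart_increment:
  assumes W: "brownian_motion M W" and rs: "0 \<le> r" "r \<le> s"
  shows "(\<integral>\<omega>. exp_mart \<theta> (W s \<omega> - W r \<omega>) (s - r) \<partial>M) = 1"
proof -
  interpret prob_space M using W by (rule brownian_motionD)
  show ?thesis
  proof (cases "r = s")
    case True
    then show ?thesis by (simp add: prob_space)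
  next
    case False
    then have "(\<integral>\<omega>. iexp (\<theta> * (W s \<omega> - W r \<omega>)) \<partial>M) = of_real (exp (- (\<theta>\<^sup>2 * (sqrt (s - r))\<^sup>2 / 2)))"
      using rs by (intro integral_iexp_normal brownian_motionD(5)[OF W]) auto
    then show ?thesis using rs
      by (simp add: exp_mart_def flip: of_real_mult exp_add)
  qed
qed

lemma (in prob_space) integrable_bounded:
  fixes f :: "'a \<Rightarrow> 'b::{banach, second_countable_topology}"
  assumes "f \<in> borel_measurable M" "\<And>x. x \<in> space M \<Longrightarrow> norm (f x) \<le> B"
  shows "integrable M f"
  using assms by (intro integrable_const_bound[of _ B]) auto

text \<open>
  The dyadic event and the martingale up to time \<open>r\<close> are functions of the increments over the grid
  of \<open>[0, r]\<close>; the remaining factor is a function of the single increment over \<open>[r, s]\<close>, independent of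
  these and of mean zero.
\<close>

lemma brownian_dyadic_increment:
  assumes W: "brownian_motion M W" and rs: "0 \<le> r" "r \<le> s"
  shows "(\<integral>\<omega>. of_bool (dyadic_far C (\<lambda>t. x + \<sigma> * W t \<omega> + \<mu> * t) r m N)
            * (exp_mart \<theta> (W s \<omega>) s - exp_mart \<theta> (W r \<omega>) r) \<partial>M) = 0"
proof -
  interpret prob_space M using W by (rule brownian_motionD)
  have [measurable]: "(\<lambda>x. infdist x C) \<in> borel_measurable borel"
    by (intro borel_measurable_continuous_onI continuous_intros)
  define n where "n = (2::nat) ^ N"
  have n: "0 < n" "(2::real) ^ N = real n" by (simp_all add: n_def)
  \<comment> \<open>The grid of \<open>[0, r]\<close>, followed by one more increment from \<open>r\<close> to \<open>s\<close>.\<close>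
  define u where "u i = (if i \<le> n then r * real i / real n else s)" for i
  have u0: "0 \<le> u 0" and u_n: "u n = r" "u (Suc n) = s"
    using rs n by (auto simp: u_def)
  have "u i \<le> u j" if "i \<le> j" for i j
  proof -
    have "r * real i / real n \<le> r" if "i \<le> n" for i
      using that rs n by (auto simp: field_simps intro: mult_left_mono)
    then show ?thesis
      using that rs n by (force simp: u_def intro!: divide_right_mono mult_left_mono order_trans[of _ r s])
  qed
  then have mono: "mono u" by (rule monoI)
  define X where "X i \<omega> = W (u (Suc i)) \<omega> - W (u i) \<omega>" for i \<omega>
  have ind: "indep_vars (\<lambda>_. borel) X {..<Suc n}"
    using brownian_motionD(6)[OF W u0 mono, of "Suc n"] by (simp add: X_def[abs_def])
  define PS where "PS v j = (\<Sum>i<j. v i :: real)" for v :: "nat \<Rightarrow> real" and j :: nat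
  define F where "F v = of_bool (\<forall>j\<le>n. inverse (real (Suc m))
      \<le> infdist (x + \<sigma> * PS v j + \<mu> * (r * real j / real n)) C) * exp_mart \<theta> (PS v n) r"
    for v :: "nat \<Rightarrow> real"
  define G where "G v = exp_mart \<theta> (v n) (s - r) - 1" for v :: "nat \<Rightarrow> real"
  have [measurable]: "(\<lambda>v. PS v j) \<in> borel_measurable (PiM {..<n} (\<lambda>_. borel))" if "j \<le> n" for j
    unfolding PS_def using that by (intro borel_measurable_sum measurable_component_singleton) auto
  have F[measurable]: "F \<in> borel_measurable (PiM {..<n} (\<lambda>_. borel))"
    unfolding F_def by measurable
  have G[measurable]: "G \<in> borel_measurable (PiM {n} (\<lambda>_. borel))"
    unfolding G_def by measurable
  let ?XF = "\<lambda>\<omega>. F (\<lambda>i\<in>{..<n}. X i \<omega>)" and ?XG = "\<lambda>\<omega>. G (\<lambda>i\<in>{n}. X i \<omega>)"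
  have i1: "indep_var (PiM {..<n} (\<lambda>_. borel)) (\<lambda>\<omega>. restrict (\<lambda>i. X i \<omega>) {..<n})
      (PiM {n} (\<lambda>_. borel)) (\<lambda>\<omega>. restrict (\<lambda>i. X i \<omega>) {n})"
    by (rule indep_var_restrict[OF ind]) auto
  have i2: "indep_var borel ?XF borel ?XG"
    using indep_var_compose[OF i1 F G] by (simp add: comp_def)
  have bF: "norm (F v) \<le> exp (\<theta>\<^sup>2 / 2 * r)" for v
    by (simp add: F_def norm_mult norm_exp_mart)
  have bG: "norm (G v) \<le> exp (\<theta>\<^sup>2 / 2 * (s - r)) + 1" for v
    unfolding G_def by (rule order_trans[OF norm_triangle_ineq4]) (simp add: norm_exp_mart)
  have mF[measurable]: "?XF \<in> borel_measurable M" and mG[measurable]: "?XG \<in> borel_measurable M"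
    using indep_var_rv1[OF i2] indep_var_rv2[OF i2] by auto
  have prod: "(\<integral>\<omega>. ?XF \<omega> * ?XG \<omega> \<partial>M) = (\<integral>\<omega>. ?XF \<omega> \<partial>M) * (\<integral>\<omega>. ?XG \<omega> \<partial>M)"
    by (rule indep_var_lebesgue_integral[OF i2])
       (auto intro!: integrable_bounded bF bG mF mG)
  have [measurable]: "W s \<in> borel_measurable M" "W r \<in> borel_measurable M"
    using brownian_motionD(2)[OF W] rs by auto
  have "(\<integral>\<omega>. ?XG \<omega> \<partial>M) = (\<integral>\<omega>. exp_mart \<theta> (W s \<omega> - W r \<omega>) (s - r) - 1 \<partial>M)"
    by (simp add: G_def X_def u_n)
  also have "\<dots> = 0"
    using brownian_exp_mart_increment[OF W rs]
    by (subst Bochner_Integration.integral_diff)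
       (auto simp: prob_space norm_exp_mart intro!: integrable_bounded[of _ "exp (\<theta>\<^sup>2 / 2 * (s - r))"])
  finally have "(\<integral>\<omega>. ?XF \<omega> * ?XG \<omega> \<partial>M) = 0" by (simp add: prod)
  also have "(\<integral>\<omega>. ?XF \<omega> * ?XG \<omega> \<partial>M) =
      (\<integral>\<omega>. of_bool (dyadic_far C (\<lambda>t. x + \<sigma> * W t \<omega> + \<mu> * t) r m N)
            * (exp_mart \<theta> (W s \<omega>) s - exp_mart \<theta> (W r \<omega>) r) \<partial>M)"
  proof (rule Bochner_Integration.integral_cong[OF refl])
    fix \<omega> assume \<omega>: "\<omega> \<in> space M"
    have PS: "PS (\<lambda>i\<in>{..<n}. X i \<omega>) j = W (u j) \<omega>" if "j \<le> n" for j
    proof -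
      have "PS (\<lambda>i\<in>{..<n}. X i \<omega>) j = (\<Sum>i<j. X i \<omega>)"
        unfolding PS_def using that by (intro sum.cong) auto
      also have "\<dots> = W (u j) \<omega> - W (u 0) \<omega>" unfolding X_def by (rule sum_lessThan_telescope)
      also have "\<dots> = W (u j) \<omega>" using brownian_motionD(3)[OF W \<omega>] by (simp add: u_def[of 0])
      finally show ?thesis .
    qed
    have "(\<forall>j\<le>n. inverse (real (Suc m)) \<le> infdist (x + \<sigma> * PS (\<lambda>i\<in>{..<n}. X i \<omega>) j + \<mu> * (r * real j / real n)) C)
      \<longleftrightarrow> dyadic_far C (\<lambda>t. x + \<sigma> * W t \<omega> + \<mu> * t) r m N"
      unfolding dyadic_far_def n(2) n_def[symmetric]
      by (intro all_cong imp_cong refl) (simp add: PS u_def)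
    moreover have "exp_mart \<theta> (W s \<omega>) s = exp_mart \<theta> (W r \<omega>) r * exp_mart \<theta> (W s \<omega> - W r \<omega>) (s - r)"
      by (simp flip: exp_mart_add)
    moreover have "PS (\<lambda>i\<in>{..<n}. X i \<omega>) n = W r \<omega>" "X n \<omega> = W s \<omega> - W r \<omega>"
      using PS[OF order_refl] by (simp_all only: u_n) (simp add: X_def u_n)
    ultimately show "?XF \<omega> * ?XG \<omega> = of_bool (dyadic_far C (\<lambda>t. x + \<sigma> * W t \<omega> + \<mu> * t) r m N)
            * (exp_mart \<theta> (W s \<omega>) s - exp_mart \<theta> (W r \<omega>) r)"
      by (simp add: F_def G_def right_diff_distrib)
  qed
  finally show ?thesis .
qed

lemma tendsto_of_bool_decreasing:
  fixes P :: "nat \<Rightarrow> bool"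
  assumes "\<And>i j. i \<le> j \<Longrightarrow> P j \<Longrightarrow> P i"
  shows "(\<lambda>n. of_bool (P n) :: 'a::{topological_space, zero_neq_one}) \<longlonglongrightarrow> of_bool (\<forall>n. P n)"
proof (cases "\<forall>n. P n")
  case False
  then obtain k where "\<not> P k" by blast
  then have "\<forall>\<^sub>F n in sequentially. of_bool (P n) = (0 :: 'a)"
    using assms by (auto intro!: eventually_sequentiallyI[of k])
  then show ?thesis using False by (simp add: tendsto_eventually)
qed simp

lemma tendsto_of_bool_increasing:
  fixes P :: "nat \<Rightarrow> bool"
  assumes "\<And>i j. i \<le> j \<Longrightarrow> P i \<Longrightarrow> P j"
  shows "(\<lambda>n. of_bool (P n) :: 'a::{topological_space, zero_neq_one}) \<longlonglongrightarrow> of_bool (\<exists>n. P n)"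
proof (cases "\<exists>n. P n")
  case True
  then obtain k where "P k" by blast
  then have "\<forall>\<^sub>F n in sequentially. of_bool (P n) = (1 :: 'a)"
    using assms by (auto intro!: eventually_sequentiallyI[of k])
  then show ?thesis using True by (simp add: tendsto_eventually)
qed simp

definition stop_at :: "ereal \<Rightarrow> real \<Rightarrow> real" where
  "stop_at T s = real_of_ereal (min T (ereal s))"

lemma ereal_stop_at: "0 \<le> T \<Longrightarrow> ereal (stop_at T s) = min T (ereal s)"
  unfolding stop_at_def by (cases T) (auto simp: min_def)

lemma stop_at_bounds:
  assumes "0 \<le> T" "0 \<le> s"
  shows "0 \<le> stop_at T s" "stop_at T s \<le> s"
proof -
  have "ereal 0 \<le> ereal (stop_at T s)" "ereal (stop_at T s) \<le> ereal s"
    using assms by (auto simp: ereal_stop_at zero_ereal_def[symmetric])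
  then show "0 \<le> stop_at T s" "stop_at T s \<le> s" by simp_all
qed

lemma measurable_stop_at [measurable (raw)]:
  assumes [measurable]: "f \<in> borel_measurable M" "g \<in> borel_measurable M"
  shows "(\<lambda>x. stop_at (f x) (g x)) \<in> borel_measurable M"
  unfolding stop_at_def by measurable

text \<open>
  Rounding the stopped time up to the next grid point. The number \<open>n\<close> of grid points before \<open>T\<close>
  determines the rounded time, which allows the stopped process to be written as a telescoping sum.
\<close>

lemma stop_at_grid:
  fixes k :: nat
  assumes T: "0 \<le> T" and s: "0 \<le> s" and k: "0 < k"
  obtains n where "n \<le> k" "{j. j < k \<and> ereal (s * real j / real k) < T} = {..<n}"
    "\<bar>s * real n / real k - stop_at T s\<bar> \<le> s / real k"
proof -
  let ?r = "\<lambda>j::nat. s * real j / real k"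
  let ?J = "{j. j < k \<and> ereal (?r j) < T}"
  define n where "n = card ?J"
  have down: "i \<in> ?J" if "j \<in> ?J" "i \<le> j" for i j
  proof -
    have "?r i \<le> ?r j" using that s by (intro divide_right_mono mult_left_mono) auto
    then have "ereal (?r i) \<le> ereal (?r j)" by simp
    also have "\<dots> < T" using that by simp
    finally show ?thesis using that by simp
  qed
  have J: "?J = {..<n}"
  proof -
    have fin: "finite ?J" by simp
    have "?J \<subseteq> {..<n}"
    proof
      fix j assume j: "j \<in> ?J"
      then have "{..j} \<subseteq> ?J" using down by blast
      then have "card {..j} \<le> n" unfolding n_def by (intro card_mono fin)
      then show "j \<in> {..<n}" by simp
    qed
    moreover have "card ?J = card {..<n}" by (simp add: n_def)
    ultimately show ?thesis by (intro card_subset_eq) auto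
  qed
  have nk: "n \<le> k" unfolding n_def using card_mono[of "{..<k}" ?J] by auto
  have rk: "?r j \<le> s" if "j \<le> k" for j
    using that s k by (auto simp: field_simps intro: mult_left_mono)
  have "stop_at T s \<le> ?r n"
  proof (cases "n = k")
    case True
    then show ?thesis using stop_at_bounds[OF T s] k by simp
  next
    case False
    then have "n \<notin> ?J" using J by auto
    then have "T \<le> ereal (?r n)" using False nk by (auto simp: not_less)
    then have "ereal (stop_at T s) \<le> ereal (?r n)" unfolding ereal_stop_at[OF T] by (simp add: min.coboundedI1)
    then show ?thesis by simp
  qed
  moreover have "?r n \<le> stop_at T s + s / real k"
  proof (cases n)
    case 0
    then show ?thesis using stop_at_bounds[OF T s] s by simp
  next
    case (Suc i)
    then have i: "i \<in> ?J" using J by auto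
    have "ereal (?r i) \<le> ereal (stop_at T s)"
      unfolding ereal_stop_at[OF T] using i rk[of i] by (auto simp: less_imp_le)
    then have "?r i \<le> stop_at T s" by simp
    moreover have "?r n = ?r i + s / real k" using Suc k by (simp add: field_simps)
    ultimately show ?thesis by simp
  qed
  moreover have "0 \<le> s / real k" using s by simp
  ultimately have "\<bar>?r n - stop_at T s\<bar> \<le> s / real k" by linarith
  with that nk J show ?thesis by blast
qed

context
  fixes M :: "'w measure" and W :: "real \<Rightarrow> 'w \<Rightarrow> real" and C :: "real set" and x \<sigma> \<mu> :: real
  assumes W: "brownian_motion M W" and C: "closed C" "C \<noteq> {}"
begin

abbreviation drift_path :: "'w \<Rightarrow> real \<Rightarrow> real" where
  "drift_path \<omega> \<equiv> (\<lambda>t. x + \<sigma> * W t \<omega> + \<mu> * t)"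

lemma continuous_drift_path: "\<omega> \<in> space M \<Longrightarrow> continuous_on {0..} (drift_path \<omega>)"
  by (intro continuous_intros brownian_motionD(4)[OF W])

text \<open>
  The martingale property tested on the event that the set has not been hit by time \<open>r\<close>. That event
  is a countable union of countable intersections of dyadic events, so two dominated limits suffice.
\<close>

lemma brownian_increment_before_hit:
  assumes rs: "0 \<le> r" "r \<le> s"
  shows "(\<integral>\<omega>. of_bool (ereal r < hit_time C (drift_path \<omega>))
            * (exp_mart \<theta> (W s \<omega>) s - exp_mart \<theta> (W r \<omega>) r) \<partial>M) = 0"
proof -
  interpret prob_space M using W by (rule brownian_motionD)
  have [measurable]: "(\<lambda>x. infdist x C) \<in> borel_measurable borel"
    by (intro borel_measurable_continuous_onI continuous_intros)
  have Wm[measurable]: "0 \<le> t \<Longrightarrow> W t \<in> borel_measurable M" for t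
    by (rule brownian_motionD(2)[OF W])
  have [measurable]: "W s \<in> borel_measurable M" "W r \<in> borel_measurable M" using rs by auto
  have [measurable]: "(\<lambda>\<omega>. W (r * real j / 2 ^ N) \<omega>) \<in> borel_measurable M" for j N :: nat
    using rs by (intro Wm) auto
  define D where "D \<omega> = exp_mart \<theta> (W s \<omega>) s - exp_mart \<theta> (W r \<omega>) r" for \<omega>
  define B where "B = exp (\<theta>\<^sup>2 / 2 * s) + exp (\<theta>\<^sup>2 / 2 * r)"
  have [measurable]: "D \<in> borel_measurable M" unfolding D_def by measurable
  have bD: "norm (D \<omega>) \<le> B" for \<omega>
    unfolding D_def B_def by (rule order_trans[OF norm_triangle_ineq4]) (simp add: norm_exp_mart)
  have bD': "norm (of_bool P * D \<omega>) \<le> B" for P \<omega>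
    using bD[of \<omega>] order_trans[OF norm_ge_zero bD[of \<omega>]] by (cases P) auto
  have [measurable]: "Measurable.pred M (\<lambda>\<omega>. dyadic_far C (drift_path \<omega>) r m N)" for m N
    unfolding dyadic_far_def by measurable
  have "(\<lambda>N. \<integral>\<omega>. of_bool (dyadic_far C (drift_path \<omega>) r m N) * D \<omega> \<partial>M)
      \<longlonglongrightarrow> (\<integral>\<omega>. of_bool (\<forall>N. dyadic_far C (drift_path \<omega>) r m N) * D \<omega> \<partial>M)" for m
  proof (rule integral_dominated_convergence[where w = "\<lambda>_. B"], goal_cases)
    case 4
    show ?case
      by (intro AE_I2 tendsto_mult tendsto_const tendsto_of_bool_decreasing)
        (blast intro: dyadic_far_antimono)
  qed (auto simp: bD')
  moreover have "(\<integral>\<omega>. of_bool (dyadic_far C (drift_path \<omega>) r m N) * D \<omega> \<partial>M) = 0" for m N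
    unfolding D_def by (rule brownian_dyadic_increment[OF W rs])
  ultimately have z: "(\<integral>\<omega>. of_bool (\<forall>N. dyadic_far C (drift_path \<omega>) r m N) * D \<omega> \<partial>M) = 0" for m
    by (simp add: LIMSEQ_const_iff)
  have "(\<lambda>m. \<integral>\<omega>. of_bool (\<forall>N. dyadic_far C (drift_path \<omega>) r m N) * D \<omega> \<partial>M)
      \<longlonglongrightarrow> (\<integral>\<omega>. of_bool (\<exists>m. \<forall>N. dyadic_far C (drift_path \<omega>) r m N) * D \<omega> \<partial>M)"
  proof (rule integral_dominated_convergence[where w = "\<lambda>_. B"], goal_cases)
    case 4
    show ?case
      by (intro AE_I2 tendsto_mult tendsto_const tendsto_of_bool_increasing)
        (blast intro: dyadic_far_mono)
  qed (auto simp: bD')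
  then have "(\<integral>\<omega>. of_bool (\<exists>m. \<forall>N. dyadic_far C (drift_path \<omega>) r m N) * D \<omega> \<partial>M) = 0"
    by (simp add: LIMSEQ_const_iff z)
  also have "(\<integral>\<omega>. of_bool (\<exists>m. \<forall>N. dyadic_far C (drift_path \<omega>) r m N) * D \<omega> \<partial>M)
    = (\<integral>\<omega>. of_bool (ereal r < hit_time C (drift_path \<omega>)) * D \<omega> \<partial>M)"
    using less_hit_time_iff_dyadic_far[OF C continuous_drift_path rs(1)]
    by (intro Bochner_Integration.integral_cong) auto
  finally show ?thesis by (simp add: D_def)
qed

lemma measurable_hit_time_drift [measurable]:
  "(\<lambda>\<omega>. hit_time C (drift_path \<omega>)) \<in> borel_measurable M"
  using brownian_motionD(2)[OF W]
  by (intro measurable_hit_time C continuous_drift_path) auto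

text \<open>
  Along the grid with \<open>k + 1\<close> steps the stopped martingale is \<open>1\<close> plus increments taken on the events
  that the set has not been hit yet, each of mean zero. The grid times converge to the stopping time
  and the martingale is bounded up to time \<open>s\<close>, so the expectation passes to the limit.
\<close>

lemma optional_stopping_exp_mart:
  assumes s: "0 \<le> s"
  defines "\<rho> \<equiv> \<lambda>\<omega>. stop_at (hit_time C (drift_path \<omega>)) s"
  shows "(\<integral>\<omega>. exp_mart \<theta> (W (\<rho> \<omega>) \<omega>) (\<rho> \<omega>) \<partial>M) = 1"
proof -
  interpret prob_space M using W by (rule brownian_motionD)
  define \<tau> where "\<tau> \<omega> = hit_time C (drift_path \<omega>)" for \<omega>
  have \<tau>[measurable]: "\<tau> \<in> borel_measurable M" unfolding \<tau>_def by (rule measurable_hit_time_drift)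
  have \<tau>0: "0 \<le> \<tau> \<omega>" for \<omega> unfolding \<tau>_def by (rule hit_time_nonneg)
  have \<rho>_eq: "\<rho> \<omega> = stop_at (\<tau> \<omega>) s" for \<omega> by (simp add: \<rho>_def \<tau>_def)
  have \<rho>[measurable]: "\<rho> \<in> borel_measurable M" unfolding \<rho>_def \<tau>_def[symmetric] by measurable
  have \<rho>_bounds: "0 \<le> \<rho> \<omega>" "\<rho> \<omega> \<le> s" for \<omega>
    using stop_at_bounds[OF \<tau>0 s] unfolding \<rho>_def \<tau>_def by auto
  have Wm: "0 \<le> t \<Longrightarrow> W t \<in> borel_measurable M" for t
    by (rule brownian_motionD(2)[OF W])
  have [measurable]: "(\<lambda>(t, \<omega>). W (max 0 t) \<omega>) \<in> borel_measurable (borel \<Otimes>\<^sub>M M)"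
    by (intro measurable_continuous_process Wm brownian_motionD(4)[OF W])
  have "(\<lambda>\<omega>. (\<lambda>(t, \<omega>). W (max 0 t) \<omega>) (\<rho> \<omega>, \<omega>)) \<in> borel_measurable M"
    by measurable
  then have W\<rho>[measurable]: "(\<lambda>\<omega>. W (\<rho> \<omega>) \<omega>) \<in> borel_measurable M"
    using \<rho>_bounds by (simp add: max_absorb2)
  define r where "r k j = s * real j / real (Suc k)" for k j :: nat
  have r0: "0 \<le> r k j" for k j using s by (simp add: r_def)
  have [measurable]: "W (r k j) \<in> borel_measurable M" for k j by (rule Wm[OF r0])
  define d where "d k j \<omega> = exp_mart \<theta> (W (r k (Suc j)) \<omega>) (r k (Suc j)) - exp_mart \<theta> (W (r k j) \<omega>) (r k j)"
    for k j \<omega>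
  define E where "E k \<omega> = 1 + (\<Sum>j<Suc k. of_bool (ereal (r k j) < \<tau> \<omega>) * d k j \<omega>)" for k \<omega>
  have [measurable]: "d k j \<in> borel_measurable M" for k j unfolding d_def by measurable
  have [measurable]: "E k \<in> borel_measurable M" for k unfolding E_def by measurable
  have E_eq: "\<exists>q. 0 \<le> q \<and> q \<le> s \<and> \<bar>q - \<rho> \<omega>\<bar> \<le> s / real (Suc k) \<and> E k \<omega> = exp_mart \<theta> (W q \<omega>) q"
    if \<omega>: "\<omega> \<in> space M" for k \<omega>
  proof -
    obtain n where n: "n \<le> Suc k" "{j. j < Suc k \<and> ereal (r k j) < \<tau> \<omega>} = {..<n}"
      "\<bar>r k n - \<rho> \<omega>\<bar> \<le> s / real (Suc k)"
      unfolding r_def \<rho>_eq by (rule stop_at_grid[OF \<tau>0 s zero_less_Suc])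
    have "r k n \<le> s" using mult_left_mono[of "real n" "real (Suc k)" s] n(1) s by (simp add: r_def field_simps)
    moreover have "E k \<omega> = exp_mart \<theta> (W (r k n) \<omega>) (r k n)"
    proof -
      have "E k \<omega> = 1 + (\<Sum>j\<in>{j. j < Suc k \<and> ereal (r k j) < \<tau> \<omega>}. d k j \<omega>)"
        unfolding E_def by (auto simp del: sum.lessThan_Suc intro!: sum.mono_neutral_cong_right)
      also have "\<dots> = 1 + (\<Sum>j<n. d k j \<omega>)" by (simp add: n(2))
      also have "\<dots> = 1 + (exp_mart \<theta> (W (r k n) \<omega>) (r k n) - exp_mart \<theta> (W (r k 0) \<omega>) (r k 0))"
        using sum_lessThan_telescope[of "\<lambda>j. exp_mart \<theta> (W (r k j) \<omega>) (r k j)" n] by (simp add: d_def)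
      also have "\<dots> = exp_mart \<theta> (W (r k n) \<omega>) (r k n)"
        using brownian_motionD(3)[OF W \<omega>] by (simp add: r_def)
      finally show ?thesis .
    qed
    ultimately show ?thesis using n(3) r0[of k n] by blast
  qed
  have bE: "norm (E k \<omega>) \<le> exp (\<theta>\<^sup>2 / 2 * s)" if \<omega>: "\<omega> \<in> space M" for k \<omega>
    using E_eq[OF that, of k] by (auto simp: norm_exp_mart intro!: mult_left_mono)
  have lim: "(\<lambda>k. E k \<omega>) \<longlonglongrightarrow> exp_mart \<theta> (W (\<rho> \<omega>) \<omega>) (\<rho> \<omega>)" if \<omega>: "\<omega> \<in> space M" for \<omega>
  proof -
    obtain q where q: "\<And>k. 0 \<le> q k" "\<And>k. \<bar>q k - \<rho> \<omega>\<bar> \<le> s / real (Suc k)"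
      "\<And>k. E k \<omega> = exp_mart \<theta> (W (q k) \<omega>) (q k)"
      using E_eq[OF \<omega>] by metis
    have "(\<lambda>k. s * inverse (real (Suc k))) \<longlonglongrightarrow> 0"
      using LIMSEQ_inverse_real_of_nat by (rule tendsto_mult_right_zero)
    moreover have "norm (q k - \<rho> \<omega>) \<le> s * inverse (real (Suc k))" for k
      using q(2)[of k] by (simp add: divide_inverse)
    ultimately have "(\<lambda>k. q k - \<rho> \<omega>) \<longlonglongrightarrow> 0"
      by (rule_tac Lim_null_comparison[OF always_eventually[OF allI]])
    then have "q \<longlonglongrightarrow> \<rho> \<omega>" by (simp add: LIM_zero_iff)
    moreover have "continuous_on {0..} (\<lambda>t. exp_mart \<theta> (W t \<omega>) t)"
      by (intro continuous_intros brownian_motionD(4)[OF W \<omega>])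
    ultimately have "(\<lambda>k. exp_mart \<theta> (W (q k) \<omega>) (q k)) \<longlonglongrightarrow> exp_mart \<theta> (W (\<rho> \<omega>) \<omega>) (\<rho> \<omega>)"
      using q(1) \<rho>_bounds(1)
      by (intro continuous_on_tendsto_compose[where f = "\<lambda>t. exp_mart \<theta> (W t \<omega>) t"]) auto
    then show ?thesis by (simp add: q(3))
  qed
  have int_d: "integrable M (\<lambda>\<omega>. of_bool (ereal (r k j) < \<tau> \<omega>) * d k j \<omega>)" for k j
  proof (rule integrable_bounded)
    show "norm (of_bool (ereal (r k j) < \<tau> \<omega>) * d k j \<omega>)
        \<le> exp (\<theta>\<^sup>2 / 2 * r k (Suc j)) + exp (\<theta>\<^sup>2 / 2 * r k j)" for \<omega>
      using norm_triangle_ineq4[of "exp_mart \<theta> (W (r k (Suc j)) \<omega>) (r k (Suc j))" "exp_mart \<theta> (W (r k j) \<omega>) (r k j)"]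
      by (auto simp: d_def norm_exp_mart)
  qed measurable
  have "(\<integral>\<omega>. E k \<omega> \<partial>M) = 1" for k
  proof -
    have "(\<integral>\<omega>. of_bool (ereal (r k j) < \<tau> \<omega>) * d k j \<omega> \<partial>M) = 0" for j
      unfolding d_def \<tau>_def
      by (rule brownian_increment_before_hit[OF r0])
         (use s in \<open>auto simp: r_def intro!: divide_right_mono mult_left_mono\<close>)
    then have "(\<integral>\<omega>. (\<Sum>j<Suc k. of_bool (ereal (r k j) < \<tau> \<omega>) * d k j \<omega>) \<partial>M) = 0"
      by (subst Bochner_Integration.integral_sum[OF int_d]) (rule sum.neutral, blast)
    moreover have "integrable M (\<lambda>\<omega>. \<Sum>j<Suc k. of_bool (ereal (r k j) < \<tau> \<omega>) * d k j \<omega>)"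
      by (rule Bochner_Integration.integrable_sum[OF int_d])
    ultimately show ?thesis
      unfolding E_def by (subst Bochner_Integration.integral_add) (simp_all only: integrable_const, simp add: prob_space)
  qed
  moreover have "(\<lambda>k. \<integral>\<omega>. E k \<omega> \<partial>M) \<longlonglongrightarrow> (\<integral>\<omega>. exp_mart \<theta> (W (\<rho> \<omega>) \<omega>) (\<rho> \<omega>) \<partial>M)"
  proof (rule integral_dominated_convergence[where w = "\<lambda>_. exp (\<theta>\<^sup>2 / 2 * s)"], goal_cases)
    case 1 show ?case by measurable
  next
    case 4 show ?case using lim by (intro AE_I2)
  next
    case 5 show ?case using bE by (intro AE_I2)
  qed auto
  ultimately show ?thesis by (simp add: LIMSEQ_const_iff)
qed

end

section \<open>Gluing the Brownian pieces between jumps\<close>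

text \<open>
  The \<open>\<sigma>\<close>-algebra generated by one driving path, kept on the original sample space. There every path
  is continuous, which fails on the product space over all times, and hitting times become measurable.
\<close>

definition path_algebra :: "'w measure \<Rightarrow> (real \<Rightarrow> 'w \<Rightarrow> real) \<Rightarrow> 'w measure" where
  "path_algebra M X =
     vimage_algebra (space M) (\<lambda>\<omega>. \<lambda>t\<in>{0..}. X t \<omega>) (\<Pi>\<^sub>M t\<in>{0..}. borel)"

lemma space_path_algebra [simp]: "space (path_algebra M X) = space M"
  by (simp add: path_algebra_def)

lemma measurable_path_algebra: "0 \<le> t \<Longrightarrow> X t \<in> borel_measurable (path_algebra M X)"
proof -
  assume t: "0 \<le> t"
  have "(\<lambda>\<omega>. \<lambda>t\<in>{0..}. X t \<omega>) \<in> path_algebra M X \<rightarrow>\<^sub>M (\<Pi>\<^sub>M t\<in>{0..}. borel)"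
    unfolding path_algebra_def by (rule measurable_vimage_algebra1) (auto simp: space_PiM)
  from measurable_compose[OF this measurable_component_singleton[of t "{0..}" "\<lambda>_. borel"]]
  have "(\<lambda>\<omega>. (\<lambda>t\<in>{0..}. X t \<omega>) t) \<in> borel_measurable (path_algebra M X)"
    using t by simp
  then show ?thesis using t by simp
qed

lemma jump_driverD:
  assumes "jump_driver a b \<nu> M W \<xi>"
  shows "prob_space M" "brownian_motion M (W n)" "\<xi> n \<in> borel_measurable M" "distr M borel (\<xi> n) = \<nu>"
    "prob_space.indep_vars M (\<lambda>_. borel \<Otimes>\<^sub>M (\<Pi>\<^sub>M t\<in>{0..}. borel))
        (\<lambda>n \<omega>. (\<xi> n \<omega>, \<lambda>t\<in>{0..}. W n t \<omega>)) UNIV"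
  using assms unfolding jump_driver_def by blast+

text \<open>
  The form of independence used for the cycles: the identity map, read into the different generated
  \<open>\<sigma>\<close>-algebras, is an independent family.
\<close>

lemma indep_path_algebras:
  assumes J: "jump_driver a b \<nu> M W \<xi>"
  shows "prob_space.indep_vars M (\<lambda>n. path_algebra M (W n)) (\<lambda>n \<omega>. \<omega>) UNIV"
proof -
  interpret prob_space M using J by (rule jump_driverD)
  let ?P = "\<Pi>\<^sub>M t\<in>{0::real..}. (borel :: real measure)"
  let ?X = "\<lambda>n \<omega>. \<lambda>t\<in>{0..}. W n t \<omega>"
  have ind: "indep_vars (\<lambda>_. ?P) ?X UNIV"
    using indep_vars_compose2[OF jump_driverD(5)[OF J], of "\<lambda>_. snd" "\<lambda>_. ?P"] by simp
  then have X: "?X n \<in> M \<rightarrow>\<^sub>M ?P" for n unfolding indep_vars_def2 by simp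
  have "{(\<lambda>\<omega>. \<omega>) -` A \<inter> space M |A. A \<in> sets (path_algebra M (W n))}
      = {?X n -` A \<inter> space M |A. A \<in> sets ?P}" for n
    unfolding path_algebra_def by (subst sets_vimage_algebra2) (auto simp: space_PiM)
  moreover have "(\<lambda>\<omega>. \<omega>) \<in> M \<rightarrow>\<^sub>M path_algebra M (W n)" for n
    unfolding path_algebra_def by (rule measurable_vimage_algebra2) (use X in auto)
  ultimately show ?thesis
    using ind unfolding indep_vars_def2 by simp
qed

text \<open>
  Fubini's theorem for the product law of two independent variables: the first may be frozen while
  integrating over the second.
\<close>

lemma (in prob_space) integral_indep_fix_first:
  fixes H :: "'b \<times> 'b \<Rightarrow> complex"
  assumes ind: "indep_var A X B Y"
    and H[measurable]: "H \<in> borel_measurable (A \<Otimes>\<^sub>M B)" and bound: "\<And>u. norm (H u) \<le> K"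
    and h: "\<And>u. u \<in> space A \<Longrightarrow> (\<integral>\<omega>. H (u, Y \<omega>) \<partial>M) = h u"
  shows "(\<integral>\<omega>. H (X \<omega>, Y \<omega>) \<partial>M) = (\<integral>\<omega>. h (X \<omega>) \<partial>M)"
proof -
  have X[measurable]: "X \<in> M \<rightarrow>\<^sub>M A" and Y[measurable]: "Y \<in> M \<rightarrow>\<^sub>M B"
    using indep_var_rv1[OF ind] indep_var_rv2[OF ind] .
  interpret X: prob_space "distr M A X" by (rule prob_space_distr) simp
  interpret Y: prob_space "distr M B Y" by (rule prob_space_distr) simp
  interpret XY: pair_prob_space "distr M A X" "distr M B Y" ..
  have hY: "(\<integral>y. H (u, y) \<partial>distr M B Y) = h u" if "u \<in> space A" for u
    using that by (subst integral_distr) (auto simp: h)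
  have "(\<lambda>u. \<integral>y. H (u, y) \<partial>distr M B Y) \<in> borel_measurable A"
    by (rule Y.borel_measurable_lebesgue_integral) simp
  then have hm: "h \<in> borel_measurable A"
    using hY by (simp cong: measurable_cong)
  have "(\<integral>\<omega>. H (X \<omega>, Y \<omega>) \<partial>M) = (\<integral>p. H p \<partial>distr M (A \<Otimes>\<^sub>M B) (\<lambda>x. (X x, Y x)))"
    by (subst integral_distr) auto
  also have "distr M (A \<Otimes>\<^sub>M B) (\<lambda>x. (X x, Y x)) = distr M A X \<Otimes>\<^sub>M distr M B Y"
    using ind unfolding indep_var_distribution_eq by simp
  also have "(\<integral>p. H p \<partial>(distr M A X \<Otimes>\<^sub>M distr M B Y)) = (\<integral>u. (\<integral>y. H (u, y) \<partial>distr M B Y) \<partial>distr M A X)"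
    by (rule XY.integral_fst'[symmetric]) (auto intro!: XY.integrable_bounded[of _ K] bound)
  also have "\<dots> = (\<integral>u. h u \<partial>distr M A X)"
    by (rule Bochner_Integration.integral_cong) (auto simp: hY)
  also have "\<dots> = (\<integral>\<omega>. h (X \<omega>) \<partial>M)"
    by (rule integral_distr[OF X hm])
  finally show ?thesis .
qed

context
  fixes a b \<sigma> \<mu> x x0 :: real and M :: "'w measure" and W :: "nat \<Rightarrow> real \<Rightarrow> 'w \<Rightarrow> real"
begin

definition start_point :: "nat \<Rightarrow> real" where
  "start_point n = (if n = 0 then x else x0)"

definition exit_time :: "nat \<Rightarrow> 'w \<Rightarrow> ereal" where
  "exit_time n \<omega> = hit_time {a, b} (\<lambda>s. start_point n + \<sigma> * W n s \<omega> + \<mu> * s)"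

text \<open>
  The time \<open>min (jump_time n) t\<close> elapsed after \<open>n\<close> cycles, when the process is observed only up to \<open>t\<close>.
  The sample point \<open>v i\<close> of cycle \<open>i\<close> may vary with \<open>i\<close>: independence of the cycles then becomes
  integration over separate coordinates. The actual process has \<open>v\<close> constant.
\<close>

primrec clock :: "real \<Rightarrow> nat \<Rightarrow> (nat \<Rightarrow> 'w) \<Rightarrow> real" where
  "clock t 0 v = 0"
| "clock t (Suc n) v = clock t n v + stop_at (exit_time n (v n)) (t - clock t n v)"

text \<open>
  For large \<open>n\<close> this is the position at time \<open>t\<close> of the single Brownian motion that drives the process
  when the relocations are ignored.
\<close>

primrec glued :: "real \<Rightarrow> nat \<Rightarrow> (nat \<Rightarrow> 'w) \<Rightarrow> real" where
  "glued t 0 v = 0"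
| "glued t (Suc n) v =
     glued t n v + W n (stop_at (exit_time n (v n)) (t - clock t n v)) (v n)"

lemma clock_cong: "(\<And>i. i < n \<Longrightarrow> v i = v' i) \<Longrightarrow> clock t n v = clock t n v'"
  by (induction n) simp_all

lemma glued_cong: "(\<And>i. i < n \<Longrightarrow> v i = v' i) \<Longrightarrow> glued t n v = glued t n v'"
  by (induction n) (simp_all cong: clock_cong)

lemma exit_time_nonneg: "0 \<le> exit_time n \<omega>"
  unfolding exit_time_def by (rule hit_time_nonneg)

lemma clock_bounds:
  assumes "0 \<le> t"
  shows "0 \<le> clock t n v" "clock t n v \<le> t"
proof (induction n)
  case (Suc n)
  have "0 \<le> stop_at (exit_time n (v n)) (t - clock t n v)"
    "stop_at (exit_time n (v n)) (t - clock t n v) \<le> t - clock t n v"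
    using Suc by (auto intro!: stop_at_bounds exit_time_nonneg)
  with Suc show "0 \<le> clock t (Suc n) v" "clock t (Suc n) v \<le> t" by auto
qed (use assms in auto)

context
  fixes \<nu> \<xi> c d
  assumes J: "jump_driver c d \<nu> M W \<xi>"
begin

lemma W_cont: "\<omega> \<in> space M \<Longrightarrow> continuous_on {0..} (\<lambda>t. W n t \<omega>)"
  by (rule brownian_motionD(4)[OF jump_driverD(2)[OF J]])

lemma measurable_exit_time: "exit_time n \<in> borel_measurable (path_algebra M (W n))"
proof -
  have [measurable]: "0 \<le> s \<Longrightarrow> W n s \<in> borel_measurable (path_algebra M (W n))" for s
    by (rule measurable_path_algebra)
  show ?thesis
    unfolding exit_time_def[abs_def]
    by (intro measurable_hit_time continuous_intros W_cont) auto
qed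

lemma measurable_driver:
  "(\<lambda>(s, \<omega>). W n (max 0 s) \<omega>) \<in> borel_measurable (borel \<Otimes>\<^sub>M path_algebra M (W n))"
  by (rule measurable_continuous_process) (auto intro: measurable_path_algebra W_cont)

lemma measurable_clock:
  "n \<le> m \<Longrightarrow> clock t n \<in> borel_measurable (PiM {..<m} (\<lambda>i. path_algebra M (W i)))"
proof (induction n)
  case 0
  show ?case by (simp add: fun_eq_iff[symmetric])
next
  case (Suc n)
  have c: "(\<lambda>v. v n) \<in> PiM {..<m} (\<lambda>i. path_algebra M (W i)) \<rightarrow>\<^sub>M path_algebra M (W n)"
    using Suc.prems by (intro measurable_component_singleton) auto
  have [measurable]: "(\<lambda>v. exit_time n (v n)) \<in> borel_measurable (PiM {..<m} (\<lambda>i. path_algebra M (W i)))"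
    by (rule measurable_compose[OF c measurable_exit_time])
  have [measurable]: "clock t n \<in> borel_measurable (PiM {..<m} (\<lambda>i. path_algebra M (W i)))"
    using Suc by simp
  show ?case by simp
qed

lemma measurable_glued:
  assumes t: "0 \<le> t"
  shows "n \<le> m \<Longrightarrow> glued t n \<in> borel_measurable (PiM {..<m} (\<lambda>i. path_algebra M (W i)))"
proof (induction n)
  case 0
  show ?case by (simp add: fun_eq_iff[symmetric])
next
  case (Suc n)
  let ?A = "PiM {..<m} (\<lambda>i. path_algebra M (W i))"
  have c[measurable]: "(\<lambda>v. v n) \<in> ?A \<rightarrow>\<^sub>M path_algebra M (W n)"
    using Suc.prems by (intro measurable_component_singleton) auto
  have [measurable]: "(\<lambda>v. exit_time n (v n)) \<in> borel_measurable ?A"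
    by (rule measurable_compose[OF c measurable_exit_time])
  have [measurable]: "clock t n \<in> borel_measurable ?A"
    using Suc by (simp add: measurable_clock)
  have [measurable]: "glued t n \<in> borel_measurable ?A"
    using Suc by simp
  note measurable_driver[measurable]
  have "(\<lambda>v. (\<lambda>(s, \<omega>). W n (max 0 s) \<omega>) (stop_at (exit_time n (v n)) (t - clock t n v), v n))
      \<in> borel_measurable ?A"
    by measurable
  moreover have "0 \<le> stop_at (exit_time n (v n)) (t - clock t n v)" for v
    using clock_bounds[OF t, of n v] by (auto intro!: stop_at_bounds exit_time_nonneg)
  ultimately have "(\<lambda>v. W n (stop_at (exit_time n (v n)) (t - clock t n v)) (v n)) \<in> borel_measurable ?A"
    by (simp add: max_absorb2)
  then show ?case by simp
qed

lemma measurable_glued_diagonal: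
  assumes t: "0 \<le> t"
  shows "(\<lambda>\<omega>. clock t n (\<lambda>_. \<omega>)) \<in> borel_measurable M"
    and "(\<lambda>\<omega>. glued t n (\<lambda>_. \<omega>)) \<in> borel_measurable M"
proof -
  interpret prob_space M using J by (rule jump_driverD)
  let ?X = "\<lambda>\<omega>. \<lambda>i\<in>{..<n}. \<omega>"
  have "(\<lambda>\<omega>. \<omega>) \<in> M \<rightarrow>\<^sub>M path_algebra M (W i)" for i
    using indep_path_algebras[OF J] unfolding indep_vars_def2 by simp
  then have X: "?X \<in> M \<rightarrow>\<^sub>M PiM {..<n} (\<lambda>i. path_algebra M (W i))"
    by (intro measurable_restrict)
  have "clock t n (?X \<omega>) = clock t n (\<lambda>_. \<omega>)" "glued t n (?X \<omega>) = glued t n (\<lambda>_. \<omega>)" for \<omega>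
    by (auto intro!: clock_cong glued_cong)
  with measurable_compose[OF X measurable_clock[OF order_refl, of t]]
    measurable_compose[OF X measurable_glued[OF t order_refl]]
  show "(\<lambda>\<omega>. clock t n (\<lambda>_. \<omega>)) \<in> borel_measurable M"
    "(\<lambda>\<omega>. glued t n (\<lambda>_. \<omega>)) \<in> borel_measurable M"
    by simp_all
qed

text \<open>
  Given the first \<open>n\<close> cycles, the next one runs an independent Brownian motion until it exits or the
  remaining time \<open>t - clock t n\<close> is over. With the past frozen this is a deterministic horizon, so
  optional stopping for one Brownian motion applies.
\<close>

lemma integral_exp_mart_glued:
  assumes t: "0 \<le> t"
  shows "(\<integral>\<omega>. exp_mart \<theta> (glued t n (\<lambda>_. \<omega>)) (clock t n (\<lambda>_. \<omega>)) \<partial>M) = 1"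
proof (induction n)
  case 0
  interpret prob_space M using J by (rule jump_driverD)
  show ?case by (simp add: prob_space)
next
  case (Suc n)
  interpret prob_space M using J by (rule jump_driverD)
  let ?F = "\<lambda>i. path_algebra M (W i)"
  let ?A = "PiM {..<n} ?F"
  define X where "X = (\<lambda>\<omega>::'w. \<lambda>i\<in>{..<n}. \<omega>)"
  define Y where "Y = (\<lambda>\<omega>::'w. \<lambda>i\<in>{n}. \<omega>)"
  have Y: "Y \<omega> n = \<omega>" for \<omega> by (simp add: Y_def)
  define D where "D u \<omega> = stop_at (exit_time n \<omega>) (t - clock t n u)" for u \<omega>
  define H where "H = (\<lambda>(u, v). exp_mart \<theta> (glued t n u + W n (max 0 (D u (v n))) (v n)) (clock t n u + D u (v n)))"
  define h where "h u = exp_mart \<theta> (glued t n u) (clock t n u)" for u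
  have D: "0 \<le> D u \<omega>" "D u \<omega> \<le> t - clock t n u" for u \<omega>
    using clock_bounds[OF t, of n u] unfolding D_def by (auto intro!: stop_at_bounds exit_time_nonneg)
  have ind: "indep_var ?A X (PiM {n} ?F) Y"
    unfolding X_def Y_def by (rule indep_var_restrict[OF indep_path_algebras[OF J]]) auto
  have c[measurable]: "(\<lambda>v. v n) \<in> PiM {n} ?F \<rightarrow>\<^sub>M ?F n"
    by (rule measurable_component_singleton) simp
  let ?B = "?A \<Otimes>\<^sub>M PiM {n} ?F"
  note measurable_driver[measurable] measurable_exit_time[measurable]
  have [measurable]: "clock t n \<in> borel_measurable ?A" "glued t n \<in> borel_measurable ?A"
    using t by (simp_all add: measurable_clock measurable_glued)
  have [measurable]: "(\<lambda>p. D (fst p) (snd p n)) \<in> borel_measurable ?B"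
    unfolding D_def by measurable
  have "(\<lambda>p. (\<lambda>(s, \<omega>). W n (max 0 s) \<omega>) (D (fst p) (snd p n), snd p n)) \<in> borel_measurable ?B"
    by measurable
  then have [measurable]: "(\<lambda>p. W n (max 0 (D (fst p) (snd p n))) (snd p n)) \<in> borel_measurable ?B"
    by simp
  have H: "H \<in> borel_measurable ?B"
    unfolding H_def case_prod_beta by measurable
  have "norm (H p) \<le> exp (\<theta>\<^sup>2 / 2 * t)" for p
  proof -
    have "clock t n (fst p) + D (fst p) (snd p n) \<le> t" using D(2)[of "fst p" "snd p n"] by simp
    then have "\<theta>\<^sup>2 / 2 * (clock t n (fst p) + D (fst p) (snd p n)) \<le> \<theta>\<^sup>2 / 2 * t"
      by (rule mult_left_mono) simp
    then show ?thesis
      by (simp add: H_def case_prod_beta norm_exp_mart)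
  qed
  moreover have "(\<integral>\<omega>. H (u, Y \<omega>) \<partial>M) = h u" for u
  proof -
    have "(\<integral>\<omega>. H (u, Y \<omega>) \<partial>M) = (\<integral>\<omega>. h u * exp_mart \<theta> (W n (D u \<omega>) \<omega>) (D u \<omega>) \<partial>M)"
      using D by (simp add: H_def h_def Y exp_mart_add max_absorb2)
    also have "\<dots> = h u * (\<integral>\<omega>. exp_mart \<theta> (W n (D u \<omega>) \<omega>) (D u \<omega>) \<partial>M)"
      by simp
    also have "(\<integral>\<omega>. exp_mart \<theta> (W n (D u \<omega>) \<omega>) (D u \<omega>) \<partial>M) = 1"
      unfolding D_def exit_time_def
      by (rule optional_stopping_exp_mart[OF jump_driverD(2)[OF J]])
         (use clock_bounds[OF t, of n u] in auto)
    finally show ?thesis by simp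
  qed
  ultimately have "(\<integral>\<omega>. H (X \<omega>, Y \<omega>) \<partial>M) = (\<integral>\<omega>. h (X \<omega>) \<partial>M)"
    by (intro integral_indep_fix_first[OF ind H])
  moreover have "clock t n (X \<omega>) = clock t n (\<lambda>_. \<omega>)" "glued t n (X \<omega>) = glued t n (\<lambda>_. \<omega>)" for \<omega>
    by (auto simp: X_def intro!: clock_cong glued_cong)
  ultimately show ?case
    using Suc D(1)[of "X _", unfolded D_def] by (simp add: H_def h_def D_def Y max_absorb2)
qed

end

end

section \<open>The jump diffusion modulo half the interval length\<close>

lemma iexp_add: "iexp (u + v) = iexp u * iexp v"
  by (simp add: distrib_left exp_add)

context
  fixes a b \<sigma> \<mu> x z :: real and W :: "nat \<Rightarrow> real \<Rightarrow> 'w \<Rightarrow> real" and \<xi> :: "nat \<Rightarrow> 'w \<Rightarrow> real" and \<omega> :: 'w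
  assumes \<xi>: "\<And>n. \<xi> n \<omega> = z"
    and cont: "\<And>n. continuous_on {0..} (\<lambda>t. W n t \<omega>)" and W0: "\<And>n. W n 0 \<omega> = 0"
begin

lemma cycle_path_start:
  "cycle_path \<sigma> \<mu> W \<xi> x n s \<omega> = start_point x z n + \<sigma> * W n s \<omega> + \<mu> * s"
  by (simp add: cycle_path_def start_point_def \<xi>)

lemma cycle_length_exit_time: "cycle_length a b \<sigma> \<mu> W \<xi> x n \<omega> = exit_time a b \<sigma> \<mu> x z W n \<omega>"
  by (simp add: cycle_length_def exit_time_def hit_time_def cycle_path_start)

abbreviation jump_at where "jump_at n \<equiv> jump_time a b \<sigma> \<mu> W \<xi> x n \<omega>"
abbreviation exit_at where "exit_at n \<equiv> exit_time a b \<sigma> \<mu> x z W n \<omega>"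
abbreviation clock_at where "clock_at t n \<equiv> clock a b \<sigma> \<mu> x z W t n (\<lambda>_. \<omega>)"
abbreviation glued_at where "glued_at t n \<equiv> glued a b \<sigma> \<mu> x z W t n (\<lambda>_. \<omega>)"

lemma jump_time_Suc: "jump_at (Suc n) = jump_at n + exit_at n"
  by (simp add: jump_time_def cycle_length_exit_time)

lemma jump_time_0: "jump_at 0 = 0" by (simp add: jump_time_def)

lemma jump_time_nonneg: "0 \<le> jump_at n"
  by (auto simp: jump_time_def cycle_length_exit_time intro!: sum_nonneg exit_time_nonneg)

text \<open>
  Links the recursive clock with the jump times that define the process.
\<close>

lemma clock_eq_min_jump_time:
  assumes t: "0 \<le> t"
  shows "ereal (clock_at t n) = min (jump_at n) (ereal t)"
proof (induction n)
  case 0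
  show ?case using t by (simp add: jump_time_0 zero_ereal_def)
next
  case (Suc n)
  have e: "0 \<le> exit_at n" by (rule exit_time_nonneg)
  have "ereal (clock_at t (Suc n)) = ereal (clock_at t n) + min (exit_at n) (ereal (t - clock_at t n))"
    by (simp add: ereal_stop_at[OF e, symmetric])
  also have "\<dots> = min (jump_at n + exit_at n) (ereal t)"
    using Suc e jump_time_nonneg[of n] clock_bounds[OF t, of a b \<sigma> \<mu> x z W n "\<lambda>_. \<omega>"]
    by (cases "jump_at n"; cases "exit_at n") (auto simp: min_def split: if_splits)
  finally show ?case by (simp add: jump_time_Suc)
qed

lemma clock_eq_jump_time:
  assumes "0 \<le> t" "jump_at n \<le> ereal t"
  shows "jump_at n = ereal (clock_at t n)"
  using clock_eq_min_jump_time[OF assms(1), of n] assms(2) by (simp add: min_absorb1)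

context
  fixes \<kappa> :: real
  assumes period: "iexp (\<kappa> * a) = iexp (\<kappa> * z)" "iexp (\<kappa> * b) = iexp (\<kappa> * z)"
begin

text \<open>
  At the end of each completed cycle the path sits in \<open>{a, b}\<close>, where \<open>exp (\<i> \<kappa> y)\<close> has the same value
  as at the relocation point. So the glued path without jumps keeps the phase of the process with jumps.
\<close>

lemma iexp_at_jump:
  assumes t: "0 \<le> t"
  shows "jump_at n \<le> ereal t \<Longrightarrow>
    iexp (\<kappa> * (x + \<sigma> * glued_at t n + \<mu> * clock_at t n)) = iexp (\<kappa> * start_point x z n)"
proof (induction n)
  case 0
  show ?case by (simp add: start_point_def)
next
  case (Suc n)
  have e: "0 \<le> exit_at n" by (rule exit_time_nonneg)
  have "jump_at n \<le> jump_at n + exit_at n" using e by (simp add: add_increasing2)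
  then have Tn: "jump_at n \<le> ereal t" using Suc.prems by (simp add: jump_time_Suc)
  have fin: "exit_at n \<le> ereal (t - clock_at t n)"
    using Suc.prems e unfolding jump_time_Suc clock_eq_jump_time[OF t Tn] by (cases "exit_at n") auto
  define s where "s = stop_at (exit_at n) (t - clock_at t n)"
  have s: "exit_at n = ereal s" using fin unfolding s_def by (simp add: ereal_stop_at[OF e])
  obtain s' where s': "0 \<le> s'" "exit_at n = ereal s'" "start_point x z n + \<sigma> * W n s' \<omega> + \<mu> * s' \<in> {a, b}"
  proof (rule hit_time_attained[of "{a, b}" "\<lambda>s. start_point x z n + \<sigma> * W n s \<omega> + \<mu> * s"])
    show "continuous_on {0..} (\<lambda>s. start_point x z n + \<sigma> * W n s \<omega> + \<mu> * s)"
      by (intro continuous_intros cont)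
    show "hit_time {a, b} (\<lambda>s. start_point x z n + \<sigma> * W n s \<omega> + \<mu> * s) < \<infinity>"
      using s by (simp add: exit_time_def)
  qed (auto simp: exit_time_def)
  have p: "iexp (\<kappa> * (start_point x z n + \<sigma> * W n s \<omega> + \<mu> * s)) = iexp (\<kappa> * z)"
    using s' s period by auto
  have "iexp (\<kappa> * (x + \<sigma> * glued_at t (Suc n) + \<mu> * clock_at t (Suc n)))
      = iexp (\<kappa> * (x + \<sigma> * glued_at t n + \<mu> * clock_at t n)) * iexp (\<kappa> * (\<sigma> * W n s \<omega> + \<mu> * s))"
    unfolding iexp_add[symmetric] by (simp add: s_def algebra_simps)
  also have "\<dots> = iexp (\<kappa> * (start_point x z n + \<sigma> * W n s \<omega> + \<mu> * s))"
    unfolding Suc.IH[OF Tn] iexp_add[symmetric] by (simp add: algebra_simps)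
  also have "\<dots> = iexp (\<kappa> * start_point x z (Suc n))" unfolding p by (simp add: start_point_def)
  finally show ?case .
qed

text \<open>
  After the last jump before \<open>t\<close> the running cycle contributes its displacement up to \<open>t\<close>, and all
  later cycles have duration zero.
\<close>

lemma iexp_jump_diffusion:
  assumes t: "0 \<le> t" and N: "ereal t < jump_at N"
  shows "iexp (\<kappa> * jump_diffusion a b \<sigma> \<mu> W \<xi> x t \<omega>) = iexp (\<kappa> * (x + \<sigma> * glued_at t N + \<mu> * t))"
    and "clock_at t N = t"
proof -
  have "N \<noteq> 0"
  proof
    assume "N = 0"
    then have "ereal t < 0" using N by (simp add: jump_time_0)
    then show False using t by simp
  qed
  then obtain k where k: "N = Suc k" by (cases N) auto
  define m where "m = (LEAST n. ereal t < jump_at (Suc n))"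
  have ex_k: "ereal t < jump_at (Suc k)" using N k by simp
  have m: "ereal t < jump_at (Suc m)" unfolding m_def by (rule LeastI[of "\<lambda>n. ereal t < jump_at (Suc n)", OF ex_k])
  have mk: "m \<le> k" unfolding m_def by (rule Least_le[of "\<lambda>n. ereal t < jump_at (Suc n)", OF ex_k])
  have Tm: "jump_at m \<le> ereal t"
  proof (cases m)
    case 0
    then show ?thesis using t by (simp add: jump_time_0)
  next
    case (Suc j)
    then have "\<not> ereal t < jump_at (Suc j)" using not_less_Least[of j "\<lambda>n. ereal t < jump_at (Suc n)"] m_def by simp
    then show ?thesis using Suc by simp
  qed
  note Tm' = clock_eq_jump_time[OF t Tm]
  define s where "s = t - clock_at t m"
  have "ereal s < exit_at m"
    using m unfolding jump_time_Suc Tm' s_def by (cases "exit_at m") auto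
  then have st: "stop_at (exit_at m) (t - clock_at t m) = s"
    unfolding s_def stop_at_def by (simp add: min_absorb2)
  have X: "jump_diffusion a b \<sigma> \<mu> W \<xi> x t \<omega> = start_point x z m + \<sigma> * W m s \<omega> + \<mu> * s"
    using ex_k unfolding jump_diffusion_def Let_def m_def[symmetric] Tm'
    by (auto simp: cycle_path_start s_def)
  have ckSuc: "clock_at t (Suc m) = t" by (simp add: st) (simp add: s_def)
  have stable: "clock_at t n = t \<and> glued_at t n = glued_at t (Suc m)" if "Suc m \<le> n" for n
    using that
  proof (induction n rule: dec_induct)
    case base
    show ?case using ckSuc by simp
  next
    case (step n)
    have "stop_at (exit_at n) 0 = 0"
      using exit_time_nonneg[of a b \<sigma> \<mu> x z W n \<omega>] by (simp add: stop_at_def min_absorb2 zero_ereal_def[symmetric])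
    then show ?case using step.IH W0 by (simp del: glued.simps(2) add: glued.simps(2)[of a b \<sigma> \<mu> x z W t n])
  qed
  have N': "clock_at t N = t" "glued_at t N = glued_at t (Suc m)" using stable[of N] mk k by auto
  show "clock_at t N = t" by (fact N')
  have "iexp (\<kappa> * (x + \<sigma> * glued_at t N + \<mu> * t))
      = iexp (\<kappa> * (x + \<sigma> * glued_at t m + \<mu> * clock_at t m)) * iexp (\<kappa> * (\<sigma> * W m s \<omega> + \<mu> * s))"
    unfolding iexp_add[symmetric] N' by (simp add: st) (simp add: s_def algebra_simps)
  also have "\<dots> = iexp (\<kappa> * jump_diffusion a b \<sigma> \<mu> W \<xi> x t \<omega>)"
    unfolding iexp_at_jump[OF t Tm] iexp_add[symmetric] X by (simp add: algebra_simps)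
  finally show "iexp (\<kappa> * jump_diffusion a b \<sigma> \<mu> W \<xi> x t \<omega>) = iexp (\<kappa> * (x + \<sigma> * glued_at t N + \<mu> * t))"
    by simp
qed

end
end

text \<open>
  A bound that is the same for all Brownian motions spares the proof that exit times of different
  cycles have the same law. Up to a small time \<open>\<delta>\<close> the drift is negligible, so on the event of an exit
  before \<open>\<delta>\<close> the Brownian displacement is at least half the distance to the boundary and the cosine in
  the optional stopping identity is at most \<open>1 - \<eta>\<close>. The mean in that identity is \<open>1\<close>, hence this event
  has probability at most one half.
\<close>

lemma exit_time_uniformly_positive:
  fixes a b z \<sigma> \<mu> :: real
  assumes z: "a < z" "z < b" and \<sigma>: "0 < \<sigma>"
  shows "\<exists>q\<ge>0. q < 1 \<and> (\<forall>(M :: 'w measure) W. brownian_motion M W \<longrightarrow>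
      (\<integral>\<omega>. exp (- stop_at (hit_time {a, b} (\<lambda>s. z + \<sigma> * W s \<omega> + \<mu> * s)) 1) \<partial>M) \<le> q)"
proof -
  define L where "L = b - a"
  define d where "d = min (z - a) (b - z)"
  have d: "0 < d" "d \<le> z - a" "d \<le> b - z" and L: "0 < L" "d \<le> L / 2"
    using z by (auto simp: d_def L_def min_def)
  define \<theta> where "\<theta> = \<sigma> / L"
  define \<eta> where "\<eta> = 1 - cos (d / (2 * L))"
  define c where "c = \<theta>\<^sup>2 / 2"
  have c: "0 < c" using \<sigma> L by (simp add: c_def \<theta>_def)
  have dL: "0 < d / (2 * L)" "d / (2 * L) \<le> 1 / 4" using d L by (auto simp: field_simps)
  have \<eta>: "0 < \<eta>"
    using cos_monotone_0_pi[of 0 "d / (2 * L)"] dL pi_gt3 by (simp add: \<eta>_def)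
  have \<eta>1: "\<eta> \<le> 1" using cos_ge_zero[of "d / (2 * L)"] dL pi_gt3 by (simp add: \<eta>_def)
  \<comment> \<open>The second bound makes the drift at most \<open>d / 2\<close>, the third makes the compensator \<open>exp (c \<delta>)\<close> too
    small to offset a loss of \<open>\<eta>\<close> on an event of probability above one half.\<close>
  define \<delta> where "\<delta> = min 1 (min (d / (2 * (\<bar>\<mu>\<bar> + 1))) (\<eta> / (2 * c)))"
  have \<delta>: "0 < \<delta>" "\<delta> \<le> 1" using d \<eta> c by (auto simp: \<delta>_def)
  have \<delta>\<mu>: "\<bar>\<mu>\<bar> * \<delta> \<le> d / 2"
  proof -
    have "(\<bar>\<mu>\<bar> + 1) * \<delta> \<le> (\<bar>\<mu>\<bar> + 1) * (d / (2 * (\<bar>\<mu>\<bar> + 1)))"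
      by (intro mult_left_mono) (auto simp: \<delta>_def)
    also have "\<dots> = d / 2" by (simp add: field_simps)
    finally show ?thesis using \<delta> by (simp add: distrib_right)
  qed
  have \<delta>c: "c * \<delta> \<le> \<eta> / 2"
  proof -
    have "c * \<delta> \<le> c * (\<eta> / (2 * c))" using c by (intro mult_left_mono) (auto simp: \<delta>_def)
    then show ?thesis using c by simp
  qed
  define q where "q = 1 / 2 + exp (- \<delta>) / 2"
  show ?thesis
  proof (intro exI[of _ q] conjI allI impI)
    show "0 \<le> q" by (simp add: q_def add_nonneg_nonneg)
    have "exp (- \<delta>) < 1" using \<delta> by simp
    then show "q < 1" unfolding q_def by linarith
    fix M :: "'w measure" and W :: "real \<Rightarrow> 'w \<Rightarrow> real"
    assume W: "brownian_motion M W"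
    interpret prob_space M using W by (rule brownian_motionD)
    define \<tau> where "\<tau> \<omega> = hit_time {a, b} (\<lambda>s. z + \<sigma> * W s \<omega> + \<mu> * s)" for \<omega>
    have \<tau>[measurable]: "\<tau> \<in> borel_measurable M"
      unfolding \<tau>_def by (rule measurable_hit_time_drift[OF W]) auto
    have \<tau>0: "0 \<le> \<tau> \<omega>" for \<omega> unfolding \<tau>_def by (rule hit_time_nonneg)
    define A where "A = {\<omega> \<in> space M. \<tau> \<omega> \<le> ereal \<delta>}"
    have A[measurable]: "A \<in> sets M" unfolding A_def by measurable
    define \<rho> where "\<rho> \<omega> = stop_at (\<tau> \<omega>) \<delta>" for \<omega>
    have \<rho>: "0 \<le> \<rho> \<omega>" "\<rho> \<omega> \<le> \<delta>" for \<omega>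
      using stop_at_bounds[OF \<tau>0, of \<delta> \<omega>] \<delta> by (auto simp: \<rho>_def)
    have opt: "(\<integral>\<omega>. exp_mart \<theta> (W (\<rho> \<omega>) \<omega>) (\<rho> \<omega>) \<partial>M) = 1"
      unfolding \<rho>_def \<tau>_def using \<delta> by (intro optional_stopping_exp_mart[OF W]) auto
    have int: "integrable M (\<lambda>\<omega>. exp_mart \<theta> (W (\<rho> \<omega>) \<omega>) (\<rho> \<omega>))"
      by (rule ccontr) (use opt not_integrable_integral_eq in force)
    have pt: "Re (exp_mart \<theta> (W (\<rho> \<omega>) \<omega>) (\<rho> \<omega>)) \<le> exp (c * \<delta>) * (1 - \<eta> * indicator A \<omega>)"
      if \<omega>: "\<omega> \<in> space M" for \<omega>
    proof -
      have Re: "Re (exp_mart \<theta> (W (\<rho> \<omega>) \<omega>) (\<rho> \<omega>)) = cos (\<theta> * W (\<rho> \<omega>) \<omega>) * exp (c * \<rho> \<omega>)"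
        by (simp add: exp_mart_def c_def Re_exp)
      have cos: "cos (\<theta> * W (\<rho> \<omega>) \<omega>) \<le> 1 - \<eta> * indicator A \<omega>"
      proof (cases "\<omega> \<in> A")
        case True
        then have le: "\<tau> \<omega> \<le> ereal \<delta>" by (simp add: A_def)
        obtain s where s: "0 \<le> s" "\<tau> \<omega> = ereal s" "z + \<sigma> * W s \<omega> + \<mu> * s \<in> {a, b}"
        proof (rule hit_time_attained[of "{a, b}" "\<lambda>s. z + \<sigma> * W s \<omega> + \<mu> * s"])
          show "continuous_on {0..} (\<lambda>s. z + \<sigma> * W s \<omega> + \<mu> * s)"
            by (intro continuous_intros brownian_motionD(4)[OF W \<omega>])
          show "hit_time {a, b} (\<lambda>s. z + \<sigma> * W s \<omega> + \<mu> * s) < \<infinity>"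
            using le by (auto simp: \<tau>_def[symmetric] order.strict_trans1)
        qed (auto simp: \<tau>_def)
        have \<rho>s: "\<rho> \<omega> = s" using s le by (simp add: \<rho>_def stop_at_def min_absorb1)
        have "\<bar>\<mu> * s\<bar> \<le> \<bar>\<mu>\<bar> * \<delta>" using s le by (simp add: abs_mult mult_left_mono)
        then have \<mu>s: "\<bar>\<mu> * s\<bar> \<le> d / 2" using \<delta>\<mu> by simp
        have "d / 2 \<le> \<bar>\<sigma> * W s \<omega>\<bar>" "\<bar>\<sigma> * W s \<omega>\<bar> \<le> 2 * L"
          using s(3) \<mu>s d L unfolding L_def by auto
        then have "d / (2 * L) \<le> \<bar>\<sigma> * W s \<omega>\<bar> / L" "\<bar>\<sigma> * W s \<omega>\<bar> / L \<le> 2"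
          using L by (simp_all add: field_simps)
        moreover have "\<bar>\<sigma> * W s \<omega>\<bar> / L = \<bar>\<theta> * W s \<omega>\<bar>"
          using L by (simp add: \<theta>_def abs_mult)
        ultimately have "d / (2 * L) \<le> \<bar>\<theta> * W s \<omega>\<bar>" "\<bar>\<theta> * W s \<omega>\<bar> \<le> 2" using L by auto
        then have "cos \<bar>\<theta> * W s \<omega>\<bar> \<le> cos (d / (2 * L))"
          using dL pi_gt3 by (intro cos_monotone_0_pi_le) auto
        then show ?thesis using True by (simp add: \<eta>_def \<rho>s)
      qed simp
      have "cos (\<theta> * W (\<rho> \<omega>) \<omega>) * exp (c * \<rho> \<omega>) \<le> (1 - \<eta> * indicator A \<omega>) * exp (c * \<rho> \<omega>)"
        by (intro mult_right_mono cos) simp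
      also have "\<dots> \<le> (1 - \<eta> * indicator A \<omega>) * exp (c * \<delta>)"
        using \<rho>[of \<omega>] c \<eta>1 by (intro mult_left_mono) (auto simp: indicator_def)
      finally show ?thesis unfolding Re by (simp add: mult.commute)
    qed
    have int_A: "integrable M (\<lambda>\<omega>. k * indicator A \<omega>)" for k :: real
      by (intro integrable_mult_right integrable_real_indicator A) (simp add: emeasure_eq_measure)
    have int': "integrable M (\<lambda>\<omega>. 1 - \<eta> * indicator A \<omega>)"
      by (intro Bochner_Integration.integrable_diff integrable_const int_A)
    have "1 = (\<integral>\<omega>. Re (exp_mart \<theta> (W (\<rho> \<omega>) \<omega>) (\<rho> \<omega>)) \<partial>M)"
      using opt int by simp
    also have "\<dots> \<le> (\<integral>\<omega>. exp (c * \<delta>) * (1 - \<eta> * indicator A \<omega>) \<partial>M)"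
      by (rule integral_mono) (use int int' pt in simp_all)
    also have "\<dots> = exp (c * \<delta>) * (1 - \<eta> * prob A)"
      by (subst integral_mult_right_zero, subst Bochner_Integration.integral_diff[OF _ int_A])
        (simp_all add: prob_space A)
    finally have "exp (- (c * \<delta>)) * 1 \<le> exp (- (c * \<delta>)) * (exp (c * \<delta>) * (1 - \<eta> * prob A))"
      by (intro mult_left_mono) auto
    also have "\<dots> = 1 - \<eta> * prob A" by (simp add: mult.assoc[symmetric] flip: exp_add)
    finally have "\<eta> * prob A \<le> \<eta> * (1 / 2)"
      using exp_ge_add_one_self[of "- (c * \<delta>)"] \<delta>c by simp
    then have pA: "prob A \<le> 1 / 2" using \<eta> by simp
    have "(\<integral>\<omega>. exp (- stop_at (\<tau> \<omega>) 1) \<partial>M) \<le> (\<integral>\<omega>. exp (- \<delta>) + (1 - exp (- \<delta>)) * indicator A \<omega> \<partial>M)"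
    proof (rule integral_mono)
      show "integrable M (\<lambda>\<omega>. exp (- stop_at (\<tau> \<omega>) 1))"
        using stop_at_bounds(1)[OF \<tau>0, of 1] by (intro integrable_bounded[of _ 1]) auto
      fix \<omega> assume \<omega>: "\<omega> \<in> space M"
      show "exp (- stop_at (\<tau> \<omega>) 1) \<le> exp (- \<delta>) + (1 - exp (- \<delta>)) * indicator A \<omega>"
      proof (cases "\<omega> \<in> A")
        case True
        then show ?thesis using stop_at_bounds(1)[OF \<tau>0, of 1 \<omega>] by simp
      next
        case False
        then have "ereal \<delta> < \<tau> \<omega>" using \<omega> by (auto simp: A_def)
        then have "ereal \<delta> \<le> ereal (stop_at (\<tau> \<omega>) 1)"
          using \<delta> by (simp add: ereal_stop_at[OF \<tau>0] less_imp_le)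
        then show ?thesis using False by simp
      qed
    qed (intro Bochner_Integration.integrable_add integrable_const int_A)
    also have "\<dots> = exp (- \<delta>) + (1 - exp (- \<delta>)) * prob A"
      by (subst Bochner_Integration.integral_add[OF _ int_A]) (simp_all add: prob_space A)
    also have "\<dots> \<le> exp (- \<delta>) + (1 - exp (- \<delta>)) * (1 / 2)"
      using pA \<delta> by (intro add_left_mono mult_left_mono) auto
    also have "\<dots> = q" by (simp add: q_def field_simps)
    finally show "(\<integral>\<omega>. exp (- stop_at (hit_time {a, b} (\<lambda>s. z + \<sigma> * W s \<omega> + \<mu> * s)) 1) \<partial>M) \<le> q"
      by (simp add: \<tau>_def)
  qed
qed

section \<open>The law of the jump diffusion\<close>

text \<open>
  Independence turns \<open>exp\<close> of minus the total duration of \<open>N\<close> cycles into a product of \<open>N\<close> factors at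
  most \<open>q < 1\<close>, so the total duration cannot stay below \<open>t\<close>. The durations are cut off at \<open>1\<close> to be
  finite real numbers. The sum starts at \<open>1\<close> because the first
  cycle starts at \<open>x\<close> instead of \<open>x0\<close>.
\<close>

lemma AE_exit_times_accumulate:
  fixes M :: "'w measure"
  assumes J: "jump_driver c d \<nu> M W \<xi>" and x0: "a < x0" "x0 < b" and \<sigma>: "0 < \<sigma>"
  shows "AE \<omega> in M. \<exists>N. t < (\<Sum>i\<in>{1..N}. stop_at (exit_time a b \<sigma> \<mu> x x0 W i \<omega>) 1)"
proof -
  interpret prob_space M using J by (rule jump_driverD)
  obtain q where q: "0 \<le> q" "q < 1"
    "\<forall>(M :: 'w measure) W. brownian_motion M W \<longrightarrow>
      (\<integral>\<omega>. exp (- stop_at (hit_time {a, b} (\<lambda>s. x0 + \<sigma> * W s \<omega> + \<mu> * s)) 1) \<partial>M) \<le> q"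
    using exit_time_uniformly_positive[OF x0 \<sigma>, of \<mu>] by blast
  define Z where "Z i \<omega> = stop_at (exit_time a b \<sigma> \<mu> x x0 W i \<omega>) 1" for i \<omega>
  have Z0: "0 \<le> Z i \<omega>" for i \<omega> unfolding Z_def by (rule stop_at_bounds) (auto intro: exit_time_nonneg)
  have ZF: "Z i \<in> borel_measurable (path_algebra M (W i))" for i
    using measurable_exit_time[OF J] unfolding Z_def by measurable
  have ind: "indep_vars (\<lambda>_. borel) (\<lambda>i \<omega>. exp (- Z i \<omega>)) UNIV"
    by (rule indep_vars_compose2[OF indep_path_algebras[OF J]]) (use ZF in measurable)
  then have Zm'[measurable]: "(\<lambda>\<omega>. exp (- Z i \<omega>)) \<in> borel_measurable M" for i
    unfolding indep_vars_def2 by simp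
  have "(\<lambda>\<omega>. ln (exp (- Z i \<omega>))) \<in> borel_measurable M" for i by measurable
  then have Zm[measurable]: "Z i \<in> borel_measurable M" for i by simp
  have int: "integrable M (\<lambda>\<omega>. exp (- Z i \<omega>))" for i
    using Z0 by (intro integrable_bounded[of _ 1]) auto
  define B where "B = {\<omega> \<in> space M. \<forall>N. (\<Sum>i\<in>{1..N}. Z i \<omega>) \<le> t}"
  have B[measurable]: "B \<in> sets M" unfolding B_def by measurable
  have "exp (- t) * prob B \<le> q ^ N" for N
  proof -
    have "exp (- t) * prob B = (\<integral>\<omega>. exp (- t) * indicator B \<omega> \<partial>M)"
      by simp
    also have "\<dots> \<le> (\<integral>\<omega>. (\<Prod>i\<in>{1..N}. exp (- Z i \<omega>)) \<partial>M)"
    proof (rule integral_mono)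
      show "integrable M (\<lambda>\<omega>. exp (- t) * indicator B \<omega>)"
        by (intro integrable_mult_right integrable_real_indicator B) (simp add: emeasure_eq_measure)
      show "integrable M (\<lambda>\<omega>. \<Prod>i\<in>{1..N}. exp (- Z i \<omega>))"
        using Z0 by (intro integrable_bounded[of _ 1]) (auto simp: abs_prod intro!: prod_le_1)
      fix \<omega> assume "\<omega> \<in> space M"
      have "(\<Prod>i\<in>{1..N}. exp (- Z i \<omega>)) = exp (- (\<Sum>i\<in>{1..N}. Z i \<omega>))"
        by (simp add: exp_sum sum_negf[symmetric])
      then show "exp (- t) * indicator B \<omega> \<le> (\<Prod>i\<in>{1..N}. exp (- Z i \<omega>))"
        by (auto simp: B_def indicator_def)
    qed
    also have "\<dots> = (\<Prod>i\<in>{1..N}. \<integral>\<omega>. exp (- Z i \<omega>) \<partial>M)"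
      by (rule indep_vars_lebesgue_integral[OF _ indep_vars_subset[OF ind]]) (auto intro: int)
    also have "\<dots> \<le> (\<Prod>i\<in>{1..N}. q)"
    proof (intro prod_mono conjI)
      fix i assume "i \<in> {1..N}"
      then have "start_point x x0 i = x0" by (simp add: start_point_def)
      then show "(\<integral>\<omega>. exp (- Z i \<omega>) \<partial>M) \<le> q"
        using q(3)[rule_format, OF jump_driverD(2)[OF J, of i]] by (simp add: Z_def exit_time_def)
    qed auto
    finally show ?thesis by simp
  qed
  moreover have "(\<lambda>N. q ^ N) \<longlonglongrightarrow> 0" using q by (intro LIMSEQ_power_zero) simp
  ultimately have "exp (- t) * prob B \<le> 0" by (intro LIMSEQ_le_const) auto
  then have "prob B \<le> 0" by (simp add: mult_le_0_iff)
  then have "prob B = 0" using measure_nonneg[of M B] by simp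
  then have "AE \<omega> in M. \<omega> \<notin> B" by (simp add: prob_eq_0)
  then show ?thesis
    by (rule AE_mp) (auto simp: B_def not_le Z_def intro!: AE_I2)
qed

text \<open>
  The law of the process is a push-forward, which is meaningful only for a measurable map.
\<close>

lemma measurable_jump_diffusion:
  assumes J: "jump_driver c d \<nu> M W \<xi>" and t: "0 \<le> t"
  shows "jump_diffusion a b \<sigma> \<mu> W \<xi> x t \<in> borel_measurable M"
proof -
  have W: "brownian_motion M (W n)" for n by (rule jump_driverD(2)[OF J])
  have [measurable]: "\<xi> n \<in> borel_measurable M" for n by (rule jump_driverD(3)[OF J])
  have Wm[measurable]: "0 \<le> s \<Longrightarrow> W n s \<in> borel_measurable M" for n s by (rule brownian_motionD(2)[OF W])
  have cpm: "cycle_path \<sigma> \<mu> W \<xi> x n s \<in> borel_measurable M" if "0 \<le> s" for n s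
    using that unfolding cycle_path_def by measurable
  have cpc: "continuous_on {0..} (\<lambda>s. cycle_path \<sigma> \<mu> W \<xi> x n s \<omega>)" if "\<omega> \<in> space M" for n \<omega>
    unfolding cycle_path_def by (intro continuous_intros brownian_motionD(4)[OF W that])
  have [measurable]: "cycle_length a b \<sigma> \<mu> W \<xi> x n \<in> borel_measurable M" for n
    unfolding cycle_length_def[abs_def] hit_time_def[symmetric]
    by (intro measurable_hit_time cpm cpc) auto
  have [measurable]: "jump_time a b \<sigma> \<mu> W \<xi> x n \<in> borel_measurable M" for n
    unfolding jump_time_def[abs_def] by measurable
  have [measurable]: "(\<lambda>(s, \<omega>). cycle_path \<sigma> \<mu> W \<xi> x n (max 0 s) \<omega>) \<in> borel_measurable (borel \<Otimes>\<^sub>M M)" for n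
    by (intro measurable_continuous_process cpm cpc)
  let ?P = "\<lambda>n \<omega>. ereal t < jump_time a b \<sigma> \<mu> W \<xi> x (Suc n) \<omega>"
  let ?L = "\<lambda>\<omega>. LEAST n. ?P n \<omega>"
  let ?s = "\<lambda>n \<omega>. t - real_of_ereal (jump_time a b \<sigma> \<mu> W \<xi> x n \<omega>)"
  have "(\<lambda>\<omega>. (\<lambda>(s, \<omega>). cycle_path \<sigma> \<mu> W \<xi> x n (max 0 s) \<omega>) (?s n \<omega>, \<omega>)) \<in> borel_measurable M" for n
    by measurable
  then have [measurable]: "(\<lambda>\<omega>. cycle_path \<sigma> \<mu> W \<xi> x n (max 0 (?s n \<omega>)) \<omega>) \<in> borel_measurable M" for n
    by simp
  have [measurable]: "?L \<in> M \<rightarrow>\<^sub>M count_space UNIV" by measurable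
  have [measurable]: "(\<lambda>\<omega>. cycle_path \<sigma> \<mu> W \<xi> x (?L \<omega>) (max 0 (?s (?L \<omega>) \<omega>)) \<omega>) \<in> borel_measurable M"
    by (rule measurable_compose_countable[where g = ?L and
          f = "\<lambda>n \<omega>. cycle_path \<sigma> \<mu> W \<xi> x n (max 0 (?s n \<omega>)) \<omega>"]) measurable
  have "jump_diffusion a b \<sigma> \<mu> W \<xi> x t = (\<lambda>\<omega>. if \<exists>n. ?P n \<omega>
      then cycle_path \<sigma> \<mu> W \<xi> x (?L \<omega>) (max 0 (?s (?L \<omega>) \<omega>)) \<omega> else x)"
  proof
    fix \<omega>
    have "0 \<le> ?s (?L \<omega>) \<omega>" if ex: "\<exists>n. ?P n \<omega>"
    proof (cases "?L \<omega>")
      case 0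
      then show ?thesis using t by (simp add: jump_time_def)
    next
      case (Suc j)
      then have "jump_time a b \<sigma> \<mu> W \<xi> x (?L \<omega>) \<omega> \<le> ereal t"
        using not_less_Least[of j "\<lambda>n. ?P n \<omega>"] by simp
      then show ?thesis using t by (cases "jump_time a b \<sigma> \<mu> W \<xi> x (?L \<omega>) \<omega>") auto
    qed
    then show "jump_diffusion a b \<sigma> \<mu> W \<xi> x t \<omega> = (if \<exists>n. ?P n \<omega>
      then cycle_path \<sigma> \<mu> W \<xi> x (?L \<omega>) (max 0 (?s (?L \<omega>) \<omega>)) \<omega> else x)"
      by (simp add: jump_diffusion_def Let_def max_absorb2)
  qed
  moreover have "\<dots> \<in> borel_measurable M" by measurable
  ultimately show ?thesis by simp
qed

text \<open>
  Almost surely the jump times exceed \<open>t\<close> after finitely many cycles, and from then on the phase of the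
  process is a constant multiple of the exponential martingale of the glued path, which has mean \<open>1\<close>.
\<close>

theorem char_jump_law:
  fixes M :: "'w measure"
  assumes J: "jump_driver c d (return borel x0) M W \<xi>" and x0: "a < x0" "x0 < b" and \<sigma>: "0 < \<sigma>"
    and period: "iexp (\<kappa> * a) = iexp (\<kappa> * x0)" "iexp (\<kappa> * b) = iexp (\<kappa> * x0)"
    and t: "0 \<le> t"
  shows "char (jump_law a b \<sigma> \<mu> M W \<xi> x t) \<kappa> =
    iexp (\<kappa> * (x + \<mu> * t)) * of_real (exp (- ((\<kappa> * \<sigma>)\<^sup>2 / 2 * t)))"
proof -
  interpret prob_space M using J by (rule jump_driverD)
  let ?X = "jump_diffusion a b \<sigma> \<mu> W \<xi> x t"
  let ?g = "\<lambda>N \<omega>. glued a b \<sigma> \<mu> x x0 W t N (\<lambda>_. \<omega>)" and ?c = "\<lambda>N \<omega>. clock a b \<sigma> \<mu> x x0 W t N (\<lambda>_. \<omega>)"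
  define E where "E N \<omega> = exp_mart (\<kappa> * \<sigma>) (?g N \<omega>) (?c N \<omega>)" for N \<omega>
  define K where "K = iexp (\<kappa> * (x + \<mu> * t)) * of_real (exp (- ((\<kappa> * \<sigma>)\<^sup>2 / 2 * t)))"
  have X[measurable]: "?X \<in> borel_measurable M" by (rule measurable_jump_diffusion[OF J t])
  have "AE \<omega> in M. \<xi> n \<omega> = x0" for n
  proof -
    have [measurable]: "\<xi> n \<in> borel_measurable M" by (rule jump_driverD(3)[OF J])
    have "AE y in distr M borel (\<xi> n). y = x0"
      unfolding jump_driverD(4)[OF J] by (simp add: AE_return)
    then show ?thesis by (simp add: AE_distr_iff)
  qed
  then have \<xi>: "AE \<omega> in M. \<forall>n. \<xi> n \<omega> = x0" by (simp add: AE_all_countable)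
  have lim: "AE \<omega> in M. (\<lambda>N. K * E N \<omega>) \<longlonglongrightarrow> iexp (\<kappa> * ?X \<omega>)"
    using \<xi> AE_exit_times_accumulate[OF J x0 \<sigma>, of t \<mu> x] AE_space
  proof eventually_elim
    case (elim \<omega>)
    have \<xi>: "\<And>n. \<xi> n \<omega> = x0" and cont: "\<And>n. continuous_on {0..} (\<lambda>t. W n t \<omega>)"
      and W0: "\<And>n. W n 0 \<omega> = 0"
      using elim brownian_motionD(3,4)[OF jump_driverD(2)[OF J]] by auto
    note path = \<xi> cont W0
    obtain N where N: "t < (\<Sum>i\<in>{1..N}. stop_at (exit_time a b \<sigma> \<mu> x x0 W i \<omega>) 1)"
      using elim by blast
    have late: "ereal t < jump_time a b \<sigma> \<mu> W \<xi> x m \<omega>" if "Suc N \<le> m" for m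
    proof -
      have "ereal t < ereal (\<Sum>i\<in>{1..N}. stop_at (exit_time a b \<sigma> \<mu> x x0 W i \<omega>) 1)"
        using N by simp
      also have "\<dots> = (\<Sum>i\<in>{1..N}. ereal (stop_at (exit_time a b \<sigma> \<mu> x x0 W i \<omega>) 1))" by simp
      also have "\<dots> \<le> (\<Sum>i\<in>{1..N}. exit_time a b \<sigma> \<mu> x x0 W i \<omega>)"
        by (intro sum_mono) (simp add: ereal_stop_at exit_time_nonneg)
      also have "\<dots> \<le> (\<Sum>i<m. exit_time a b \<sigma> \<mu> x x0 W i \<omega>)"
        using that by (intro sum_mono2) (auto simp: exit_time_nonneg)
      also have "\<dots> = jump_time a b \<sigma> \<mu> W \<xi> x m \<omega>"
        by (simp add: jump_time_def cycle_length_exit_time[where \<xi> = \<xi> and \<omega> = \<omega> and z = x0 and W = W, OF path])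
      finally show ?thesis .
    qed
    have "K * E m \<omega> = iexp (\<kappa> * ?X \<omega>)" if "Suc N \<le> m" for m
    proof -
      note * = iexp_jump_diffusion[where \<xi> = \<xi> and \<omega> = \<omega> and z = x0 and W = W and \<sigma> = \<sigma> and \<mu> = \<mu>
          and x = x and N = m, OF path period t late[OF that]]
      have "K * E m \<omega> = iexp (\<kappa> * (x + \<mu> * t)) * iexp (\<kappa> * \<sigma> * ?g m \<omega>)"
        by (simp add: K_def E_def exp_mart_def *(2) exp_minus)
      also have "\<dots> = iexp (\<kappa> * (x + \<sigma> * ?g m \<omega> + \<mu> * t))"
        unfolding iexp_add[symmetric] by (simp add: algebra_simps)
      finally show ?thesis by (simp only: *(1))
    qed
    then show ?case
      by (intro tendsto_eventually eventually_sequentiallyI[of "Suc N"])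
  qed
  have gc[measurable]: "?g N \<in> borel_measurable M" "?c N \<in> borel_measurable M" for N
    by (rule measurable_glued_diagonal[OF J t])+
  have "char (jump_law a b \<sigma> \<mu> M W \<xi> x t) \<kappa> = (\<integral>\<omega>. iexp (\<kappa> * ?X \<omega>) \<partial>M)"
    unfolding char_def jump_law_def by (subst integral_distr) auto
  moreover have "(\<lambda>N. \<integral>\<omega>. K * E N \<omega> \<partial>M) \<longlonglongrightarrow> (\<integral>\<omega>. iexp (\<kappa> * ?X \<omega>) \<partial>M)"
  proof (rule integral_dominated_convergence[where w = "\<lambda>_. norm K * exp ((\<kappa> * \<sigma>)\<^sup>2 / 2 * t)"], goal_cases)
    case 2 show ?case unfolding E_def by measurable
  next
    case 4 show ?case by (rule lim)
  next
    case 5 show ?case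
      using clock_bounds[OF t] by (auto simp: E_def norm_mult norm_exp_mart intro!: AE_I2 mult_left_mono)
  qed auto
  moreover have "(\<integral>\<omega>. K * E N \<omega> \<partial>M) = K" for N
    using integral_exp_mart_glued[OF J t, of "\<kappa> * \<sigma>"] by (simp add: E_def)
  ultimately show ?thesis by (simp add: LIMSEQ_const_iff K_def)
qed

section \<open>Total variation and the spectral gap\<close>

text \<open>
  A function with values in \<open>[0, 1]\<close> is, up to \<open>1 / n\<close>, the average of the indicators of its \<open>n\<close>
  superlevel sets at the heights \<open>1 / n, \<dots>, 1\<close>.
\<close>

lemma integral_diff_le_tv_dist_one_sided:
  fixes g :: "real \<Rightarrow> real"
  assumes P: "prob_space P" "sets P = sets borel" and Q: "prob_space Q" "sets Q = sets borel"
    and g[measurable]: "g \<in> borel_measurable borel" and g01: "\<And>x. 0 \<le> g x" "\<And>x. g x \<le> 1"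
  shows "(\<integral>x. g x \<partial>P) - (\<integral>x. g x \<partial>Q) \<le> tv_dist P Q"
proof -
  interpret P: prob_space P by fact
  interpret Q: prob_space Q by fact
  have [simp]: "measurable P = measurable borel" "measurable Q = measurable borel"
    using P(2) Q(2) by (auto simp: fun_eq_iff intro!: measurable_cong_sets)
  have tv: "measure P A - measure Q A \<le> tv_dist P Q" if "A \<in> sets borel" for A
  proof -
    have "bdd_above ((\<lambda>A. \<bar>measure P A - measure Q A\<bar>) ` sets borel)"
    proof (rule bdd_aboveI2)
      fix A show "\<bar>measure P A - measure Q A\<bar> \<le> 1"
        using P.prob_le_1[of A] Q.prob_le_1[of A] measure_nonneg[of P A] measure_nonneg[of Q A]
        by linarith
    qed
    from cSUP_upper[OF that this] show ?thesis by (simp add: tv_dist_def)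
  qed
  have "(\<integral>x. g x \<partial>P) - (\<integral>x. g x \<partial>Q) \<le> tv_dist P Q + inverse (real (Suc k))" for k
  proof -
    define n where "n = Suc k"
    have n: "0 < n" by (simp add: n_def)
    define A where "A j = {x. real (Suc j) \<le> real n * g x}" for j
    have A[measurable]: "A j \<in> sets borel" for j unfolding A_def by measurable
    define G where "G x = (\<Sum>j<n. indicator (A j) x) / real n" for x :: real
    have G: "G x \<le> g x" "g x \<le> G x + inverse (real n)" for x
    proof -
      have y: "0 \<le> real n * g x" "real n * g x \<le> real n" using g01[of x] n by (auto simp: mult_left_le)
      define m where "m = nat \<lfloor>real n * g x\<rfloor>"
      have m: "real m \<le> real n * g x" "real n * g x < real m + 1" using y(1) unfolding m_def by linarith+
      then have mn: "m \<le> n" using y(2) by linarith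
      have "(\<Sum>j<n. indicator (A j) x) = (\<Sum>j<m. (1::real))"
      proof (rule sum.mono_neutral_cong_right)
        show "\<forall>i\<in>{..<n} - {..<m}. indicator (A i) x = (0::real)"
          using m by (auto simp: A_def indicator_def)
        show "\<And>i. i \<in> {..<m} \<Longrightarrow> indicator (A i) x = (1::real)"
          using m by (auto simp: A_def indicator_def)
      qed (use mn in auto)
      then have Gx: "G x = real m / real n" by (simp add: G_def)
      show "G x \<le> g x" "g x \<le> G x + inverse (real n)"
        using m n by (simp_all add: Gx field_simps)
    qed
    have [measurable]: "G \<in> borel_measurable borel" unfolding G_def by measurable
    have Gb: "norm (G x) \<le> 1" for x
      using G[of x] g01[of x] unfolding G_def by (auto simp: divide_nonneg_nonneg sum_nonneg)
    have intP: "integrable P g" "integrable P G" and intQ: "integrable Q g" "integrable Q G"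
      using g01 Gb by (auto intro!: P.integrable_bounded[of _ 1] Q.integrable_bounded[of _ 1])
    have EP: "(\<integral>x. G x \<partial>P) = (\<Sum>j<n. measure P (A j)) / real n"
      unfolding G_def using P(2)
      by (subst integral_divide_zero, subst Bochner_Integration.integral_sum)
        (auto simp: P.emeasure_eq_measure sets_eq_imp_space_eq[OF P(2)])
    have EQ: "(\<integral>x. G x \<partial>Q) = (\<Sum>j<n. measure Q (A j)) / real n"
      unfolding G_def using Q(2)
      by (subst integral_divide_zero, subst Bochner_Integration.integral_sum)
        (auto simp: Q.emeasure_eq_measure sets_eq_imp_space_eq[OF Q(2)])
    have "(\<integral>x. g x \<partial>P) \<le> (\<integral>x. G x + inverse (real n) \<partial>P)"
      by (rule integral_mono) (use intP G in auto)
    also have "\<dots> = (\<integral>x. G x \<partial>P) + inverse (real n)"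
      using intP by (simp add: P.prob_space)
    finally have 1: "(\<integral>x. g x \<partial>P) \<le> (\<integral>x. G x \<partial>P) + inverse (real n)" .
    have 2: "(\<integral>x. G x \<partial>Q) \<le> (\<integral>x. g x \<partial>Q)"
      by (rule integral_mono) (use intQ G in auto)
    have "(\<integral>x. G x \<partial>P) - (\<integral>x. G x \<partial>Q) = (\<Sum>j<n. measure P (A j) - measure Q (A j)) / real n"
      unfolding EP EQ by (simp add: sum_subtractf diff_divide_distrib)
    also have "\<dots> \<le> (\<Sum>j<n. tv_dist P Q) / real n"
      by (intro divide_right_mono sum_mono tv A) simp
    also have "\<dots> = tv_dist P Q" using n by simp
    finally show ?thesis using 1 2 by (simp add: n_def)
  qed
  moreover have "(\<lambda>k. tv_dist P Q + inverse (real (Suc k))) \<longlonglongrightarrow> tv_dist P Q + 0"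
    by (intro tendsto_add tendsto_const LIMSEQ_inverse_real_of_nat)
  ultimately show ?thesis by (intro LIMSEQ_le_const[where X = "\<lambda>k. tv_dist P Q + inverse (real (Suc k))"]) auto
qed

lemma tv_dist_commute: "tv_dist P Q = tv_dist Q P"
  by (simp add: tv_dist_def abs_minus_commute)

lemma tv_dist_le_1:
  assumes "prob_space P" "prob_space Q"
  shows "tv_dist P Q \<le> 1"
  unfolding tv_dist_def
proof (rule cSUP_least)
  fix A show "\<bar>measure P A - measure Q A\<bar> \<le> 1"
    using prob_space.prob_le_1[OF assms(1), of A] prob_space.prob_le_1[OF assms(2), of A]
      measure_nonneg[of P A] measure_nonneg[of Q A]
    by linarith
qed auto

lemma integral_diff_le_tv_dist:
  fixes g :: "real \<Rightarrow> real"
  assumes "prob_space P" "sets P = sets borel" "prob_space Q" "sets Q = sets borel"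
    "g \<in> borel_measurable borel" "\<And>x. 0 \<le> g x" "\<And>x. g x \<le> 1"
  shows "\<bar>(\<integral>x. g x \<partial>P) - (\<integral>x. g x \<partial>Q)\<bar> \<le> tv_dist P Q"
  using integral_diff_le_tv_dist_one_sided[of P Q g] integral_diff_le_tv_dist_one_sided[of Q P g]
    assms by (simp add: tv_dist_commute abs_le_iff)

text \<open>
  The starting points \<open>x0\<close> and \<open>x1\<close> lie in opposite phase of the cosine. At the times \<open>T n\<close> the drift
  has moved the phase by whole periods, so the two expectations differ by \<open>exp (- r t)\<close>, and one of the
  two laws is at distance at least \<open>exp (- r t) / 2\<close> from the invariant law.
\<close>

theorem spectral_gap_le:
  fixes M :: "'w measure"
  assumes ab: "a < b" and \<sigma>: "0 < \<sigma>" and \<mu>: "0 < \<mu>" and x0: "x0 = (a + b) / 2"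
    and J: "jump_driver a b (return borel x0) M W \<xi>"
    and gap: "is_spectral_gap a b (jump_law a b \<sigma> \<mu> M W \<xi>) \<gamma>"
  shows "\<gamma> \<le> (4 * pi / (b - a) * \<sigma>)\<^sup>2 / 2"
proof -
  interpret prob_space M using J by (rule jump_driverD)
  define \<kappa> where "\<kappa> = 4 * pi / (b - a)"
  define r where "r = (\<kappa> * \<sigma>)\<^sup>2 / 2"
  let ?P = "jump_law a b \<sigma> \<mu> M W \<xi>"
  obtain \<rho> where \<rho>: "prob_space \<rho>" "sets \<rho> = sets borel"
    and lim: "((\<lambda>t. - (1 / t * ln (SUP x\<in>{a<..<b}. tv_dist (?P x t) \<rho>))) \<longlongrightarrow> \<gamma>) at_top"
    using gap unfolding is_spectral_gap_def invariant_distribution_def by blast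
  define D where "D t = (SUP x\<in>{a<..<b}. tv_dist (?P x t) \<rho>)" for t
  have inside: "a < x0" "x0 < b" using ab x0 by auto
  have per: "\<kappa> * a = \<kappa> * x0 + - (2 * pi)" "\<kappa> * b = \<kappa> * x0 + 2 * pi"
    using ab by (simp_all add: \<kappa>_def x0 field_simps)
  have i2: "iexp (2 * pi) = 1" "iexp (- (2 * pi)) = 1"
    by (simp_all add: exp_eq_polar complex_eq_iff Re_exp Im_exp)
  have period: "iexp (\<kappa> * a) = iexp (\<kappa> * x0)" "iexp (\<kappa> * b) = iexp (\<kappa> * x0)"
    unfolding per iexp_add i2 by simp_all
  define g where "g y = (1 + cos (\<kappa> * (y - x0))) / 2" for y
  have g01: "0 \<le> g y" "g y \<le> 1" for y
    using cos_ge_minus_one[of "\<kappa> * (y - x0)"] cos_le_one[of "\<kappa> * (y - x0)"]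
    by (auto simp: g_def simp del: cos_ge_minus_one cos_le_one)
  have [measurable]: "g \<in> borel_measurable borel" unfolding g_def by measurable
  have X[measurable]: "jump_diffusion a b \<sigma> \<mu> W \<xi> x t \<in> borel_measurable M" if "0 \<le> t" for x t
    by (rule measurable_jump_diffusion[OF J that])
  have Pp: "prob_space (?P x t)" "sets (?P x t) = sets borel" if "0 \<le> t" for x t
    unfolding jump_law_def using X[OF that] by (auto intro: prob_space_distr)
  have Eg: "(\<integral>y. g y \<partial>?P x t) = (1 + cos (\<kappa> * (x - x0 + \<mu> * t)) * exp (- (r * t))) / 2"
    if t: "0 \<le> t" for x t
  proof -
    interpret P: prob_space "?P x t" by (rule Pp[OF t])
    have [simp]: "measurable (?P x t) = measurable borel"
      using Pp(2)[OF t] by (auto simp: fun_eq_iff intro!: measurable_cong_sets)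
    have int: "integrable (?P x t) (\<lambda>y. iexp (\<kappa> * y))"
      by (intro P.integrable_bounded[of _ 1]) auto
    have "(\<integral>y. cos (\<kappa> * (y - x0)) \<partial>?P x t) = (\<integral>y. Re (iexp (- (\<kappa> * x0)) * iexp (\<kappa> * y)) \<partial>?P x t)"
      unfolding iexp_add[symmetric] by (simp add: Re_exp algebra_simps)
    also have "\<dots> = Re (iexp (- (\<kappa> * x0)) * char (?P x t) \<kappa>)"
      using int by (subst integral_Re) (auto simp: char_def)
    also have "\<dots> = Re (iexp (\<kappa> * (x - x0 + \<mu> * t)) * of_real (exp (- (r * t))))"
      unfolding char_jump_law[OF J inside \<sigma> period t] mult.assoc[symmetric] iexp_add[symmetric] r_def
      by (simp add: algebra_simps)
    also have "\<dots> = cos (\<kappa> * (x - x0 + \<mu> * t)) * exp (- (r * t))"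
      by (simp add: Re_exp)
    finally have c: "(\<integral>y. cos (\<kappa> * (y - x0)) \<partial>?P x t) = cos (\<kappa> * (x - x0 + \<mu> * t)) * exp (- (r * t))" .
    have "integrable (?P x t) (\<lambda>y. cos (\<kappa> * (y - x0)))"
      by (intro P.integrable_bounded[of _ 1]) auto
    then show ?thesis unfolding g_def by (simp add: c P.prob_space)
  qed
  have tvD: "tv_dist (?P x t) \<rho> \<le> D t" if t: "0 \<le> t" and x: "x \<in> {a<..<b}" for x t
    unfolding D_def using x tv_dist_le_1[OF Pp(1)[OF t] \<rho>(1)]
    by (intro cSUP_upper bdd_aboveI2[where M = 1]) auto
  define T where "T n = real (Suc n) * (b - a) / (2 * \<mu>)" for n
  have T: "0 < T n" "\<kappa> * (\<mu> * T n) = 2 * pi * real (Suc n)" for n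
    using ab \<mu> unfolding T_def \<kappa>_def by (auto intro!: divide_pos_pos mult_pos_pos)
  define x1 where "x1 = x0 + (b - a) / 4"
  have x1: "x1 \<in> {a<..<b}" "\<kappa> * (x1 - x0) = pi" using ab by (auto simp: x1_def x0 \<kappa>_def field_simps)
  have D: "exp (- (r * T n)) / 2 \<le> D (T n)" for n
  proof -
    have T0: "0 \<le> T n" using T(1)[of n] by simp
    have cosT: "cos (y + 2 * pi * real (Suc n)) = cos y" for y
      using cos_2npi[of "Suc n"] sin_2npi[of "Suc n"] by (simp add: cos_add mult_ac)
    have e0: "(\<integral>y. g y \<partial>?P x0 (T n)) = (1 + exp (- (r * T n))) / 2"
      unfolding Eg[OF T0] distrib_left T(2) cosT by simp
    have e1: "(\<integral>y. g y \<partial>?P x1 (T n)) = (1 - exp (- (r * T n))) / 2"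
      unfolding Eg[OF T0] distrib_left T(2) cosT x1(2) by simp
    have "\<bar>(\<integral>y. g y \<partial>?P x (T n)) - (\<integral>y. g y \<partial>\<rho>)\<bar> \<le> D (T n)" if "x \<in> {a<..<b}" for x
      using integral_diff_le_tv_dist[OF Pp(1)[OF T0] Pp(2)[OF T0] \<rho> _ g01] tvD[OF T0 that]
      by (meson order_trans \<open>g \<in> borel_measurable borel\<close>)
    from this[of x0] this[OF x1(1)] show ?thesis using inside unfolding e0 e1 by (auto simp: field_simps)
  qed
  have le: "- (1 / T n * ln (D (T n))) \<le> r + ln 2 / T n" for n
  proof -
    have "ln (exp (- (r * T n)) / 2) \<le> ln (D (T n))"
      using D[of n] by (intro ln_mono) (auto intro: order_less_le_trans[OF _ D])
    then have "- (r * T n) - ln 2 \<le> ln (D (T n))" by (simp add: ln_div)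
    then show ?thesis using T(1)[of n] by (simp add: field_simps)
  qed
  have Tlim: "filterlim T at_top sequentially"
  proof -
    have "filterlim (\<lambda>n. (b - a) / (2 * \<mu>) * real (Suc n)) at_top sequentially"
      using ab \<mu> by (intro filterlim_tendsto_pos_mult_at_top[OF tendsto_const]
          filterlim_compose[OF filterlim_real_sequentially filterlim_Suc]) auto
    then show ?thesis by (simp add: T_def[abs_def] mult.commute)
  qed
  have "(\<lambda>n. - (1 / T n * ln (D (T n)))) \<longlonglongrightarrow> \<gamma>"
    using filterlim_compose[OF lim Tlim] by (simp add: D_def)
  moreover have "(\<lambda>n. r + ln 2 / T n) \<longlonglongrightarrow> r + 0"
    by (intro tendsto_add tendsto_const tendsto_divide_0[OF tendsto_const] filterlim_at_top_imp_at_infinity Tlim)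
  ultimately have "\<gamma> \<le> r + 0" by (rule LIMSEQ_le) (use le in auto)
  then show ?thesis by (simp add: r_def \<kappa>_def)
qed

theorem corollary2:
  fixes a b \<sigma> :: real
    and x0 :: real
    and lambda0 :: "real \<Rightarrow> real"
  assumes "a < b" and "\<sigma> > 0"
  defines "x0 \<equiv> (a + b) / 2"
    and "lambda0 \<equiv> (\<lambda>\<mu>. \<sigma>\<^sup>2 * pi\<^sup>2 / (2 * (b - a)\<^sup>2) + \<mu>\<^sup>2 / (2 * \<sigma>\<^sup>2))"
  shows "(\<forall>\<mu>. is_lowest_eigenvalue (lambda0 \<mu>) (dirichlet_eigenvalues a b \<sigma> \<mu>)) \<and>
    (\<forall>\<^sub>F \<mu> in at_top.
       \<forall>(M :: 'w measure) W \<xi> \<gamma>.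
         jump_driver a b (return borel x0) M W \<xi> \<longrightarrow>
         is_spectral_gap a b (jump_law a b \<sigma> \<mu> M W \<xi>) \<gamma> \<longrightarrow>
         \<gamma> < lambda0 \<mu>)"
proof (intro conjI allI)
  show "is_lowest_eigenvalue (lambda0 \<mu>) (dirichlet_eigenvalues a b \<sigma> \<mu>)" for \<mu>
    unfolding lambda0_def by (rule lowest_dirichlet_eigenvalue[OF assms(1,2)])
next
  \<comment> \<open>The bound on the gap is \<open>K\<^sup>2 / 2\<close>; it lies below \<open>\<mu>\<^sup>2 / (2 \<sigma>\<^sup>2)\<close> as soon as \<open>\<mu> > K \<sigma>\<close>.\<close>
  define K where "K = 4 * pi / (b - a) * \<sigma>"
  have K: "0 < K" using assms(1,2) by (simp add: K_def)
  have "\<gamma> < lambda0 \<mu>"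
    if \<mu>: "K * \<sigma> < \<mu>" and J: "jump_driver a b (return borel x0) M W \<xi>"
      and gap: "is_spectral_gap a b (jump_law a b \<sigma> \<mu> M W \<xi>) \<gamma>"
    for \<mu> \<gamma> \<xi> W and M :: "'w measure"
  proof -
    have pos: "0 < K * \<sigma>" using K assms(2) by simp
    have "\<gamma> \<le> K\<^sup>2 / 2"
      unfolding K_def
      by (rule spectral_gap_le[OF assms(1,2) _ _ J gap]) (use pos \<mu> x0_def in auto)
    also have "K\<^sup>2 / 2 = (K * \<sigma>)\<^sup>2 / (2 * \<sigma>\<^sup>2)"
      using assms(2) by (simp add: power_mult_distrib)
    also have "\<dots> < \<mu>\<^sup>2 / (2 * \<sigma>\<^sup>2)"
      using \<mu> pos assms(2) by (intro divide_strict_right_mono power_strict_mono) auto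
    also have "\<dots> \<le> lambda0 \<mu>" by (simp add: lambda0_def)
    finally show ?thesis .
  qed
  then show "\<forall>\<^sub>F \<mu> in at_top. \<forall>(M :: 'w measure) W \<xi> \<gamma>.
      jump_driver a b (return borel x0) M W \<xi> \<longrightarrow>
      is_spectral_gap a b (jump_law a b \<sigma> \<mu> M W \<xi>) \<gamma> \<longrightarrow> \<gamma> < lambda0 \<mu>"
    by (intro eventually_mono[OF eventually_gt_at_top[of "K * \<sigma>"]]) blast
qed

end
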